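(* Let $G$ be a finite group or a compact Lie group, let $\{U(g): g\in G\}$ be a unitary representation of $G$ on a Hilbert space $\mathcal{H}$, write $\mathcal{U}(g)[X]=U(g)XU^\dagger(g)$, and let $\rho,\sigma$ be density operators on $\mathcal{H}$. The following statements are equivalent: (A) There exists a $G$-covariant quantum channel $\mathcal{E}_{G\text{-cov}}$ such that $\mathcal{E}_{G\text{-cov}}(\rho)=\sigma$. (B) There exists a quantum channel $\mathcal{E}$ such that $\mathcal{E}(\mathcal{U}(g)[\rho])=\mathcal{U}(g)[\sigma]$ for all $g\in G$.
   Context: Unitary representations of compact Lie groups are (strongly) continuous. A quantum channel is a linear, trace-preserving, completely positive map (here from operators on $\mathcal{H}$ to operators on $\mathcal{H}$). A channel $\mathcal{E}$ is $G$-covariant if $\mathcal{E}(U(g)XU^\dagger(g))=U(g)\mathcal{E}(X)U^\dagger(g)$ for all $g\in G$ and all operators $X$. *)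

theory Defs
  imports "HOL-Analysis.Analysis" "HOL-Algebra.Group"
begin

section \<open>Compact Lie groups\<close>

text \<open>For an open set in a finite-dimensional space, a map is of class \<open>C\<^sup>k\<^sup>+\<^sup>1\<close> iff it is
  differentiable and all its directional derivatives are of class \<open>C\<^sup>k\<close>.\<close>

primrec Ck_on :: "nat \<Rightarrow> 'a::euclidean_space set \<Rightarrow> ('a \<Rightarrow> 'b::euclidean_space) \<Rightarrow> bool" where
  "Ck_on 0 S f \<longleftrightarrow> continuous_on S f"
| "Ck_on (Suc k) S f \<longleftrightarrow>
     (\<exists>D. (\<forall>x\<in>S. (f has_derivative D x) (at x)) \<and> (\<forall>v. Ck_on k S (\<lambda>x. D x v)))"

definition smooth_on :: "'a::euclidean_space set \<Rightarrow> ('a \<Rightarrow> 'b::euclidean_space) \<Rightarrow> bool" where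
  "smooth_on S f \<longleftrightarrow> open S \<and> (\<forall>k. Ck_on k S f)"

definition chart :: "'g topology \<Rightarrow> 'g set \<Rightarrow> ('g \<Rightarrow> 'e::euclidean_space) \<Rightarrow> bool" where
  "chart T V \<phi> \<longleftrightarrow> openin T V \<and> open (\<phi> ` V) \<and>
     homeomorphic_map (subtopology T V) (top_of_set (\<phi> ` V)) \<phi>"

definition smooth_atlas :: "'g topology \<Rightarrow> ('g set \<times> ('g \<Rightarrow> 'e::euclidean_space)) set \<Rightarrow> bool" where
  "smooth_atlas T A \<longleftrightarrow>
     (\<forall>(V, \<phi>) \<in> A. chart T V \<phi>) \<and>
     (\<Union>(V, \<phi>) \<in> A. V) = topspace T \<and>
     (\<forall>(V, \<phi>) \<in> A. \<forall>(W, \<psi>) \<in> A. smooth_on (\<phi> ` (V \<inter> W)) (\<lambda>x. \<psi> (inv_into V \<phi> x)))"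

text \<open>The dimension of the group is \<open>DIM('e)\<close>, which is at least 1; the compact Lie groups of
  dimension 0 are exactly the finite groups (with the discrete topology).\<close>

definition lie_group ::
  "('g, 'm) monoid_scheme \<Rightarrow> 'g topology \<Rightarrow> ('g set \<times> ('g \<Rightarrow> 'e::euclidean_space)) set \<Rightarrow> bool" where
  "lie_group G T A \<longleftrightarrow>
     group G \<and> topspace T = carrier G \<and> Hausdorff_space T \<and> second_countable T \<and>
     smooth_atlas T A \<and>
     continuous_map (prod_topology T T) T (\<lambda>(g, h). g \<otimes>\<^bsub>G\<^esub> h) \<and>
     continuous_map T T (\<lambda>g. inv\<^bsub>G\<^esub> g) \<and>
     (\<forall>(V1, \<phi>1) \<in> A. \<forall>(V2, \<phi>2) \<in> A. \<forall>(W, \<psi>) \<in> A.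
        smooth_on {(\<phi>1 g, \<phi>2 h) | g h. g \<in> V1 \<and> h \<in> V2 \<and> g \<otimes>\<^bsub>G\<^esub> h \<in> W}
          (\<lambda>(x, y). \<psi> (inv_into V1 \<phi>1 x \<otimes>\<^bsub>G\<^esub> inv_into V2 \<phi>2 y))) \<and>
     (\<forall>(V, \<phi>) \<in> A. \<forall>(W, \<psi>) \<in> A.
        smooth_on {\<phi> g | g. g \<in> V \<and> inv\<^bsub>G\<^esub> g \<in> W}
          (\<lambda>x. \<psi> (inv\<^bsub>G\<^esub> (inv_into V \<phi> x))))"

definition compact_lie_group ::
  "('g, 'm) monoid_scheme \<Rightarrow> 'g topology \<Rightarrow> ('g set \<times> ('g \<Rightarrow> 'e::euclidean_space)) set \<Rightarrow> bool" where
  "compact_lie_group G T A \<longleftrightarrow> lie_group G T A \<and> compact_space T"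


section \<open>Complex Hilbert spaces and their operators\<close>

text \<open>The inner product is antilinear in its first argument. Its definiteness follows from
  \<open>norm_cinner\<close>.\<close>

class chilbert_space = banach +
  fixes scaleC :: "complex \<Rightarrow> 'a \<Rightarrow> 'a" (infixr \<open>*\<^sub>C\<close> 75)
    and cinner :: "'a \<Rightarrow> 'a \<Rightarrow> complex"
  assumes scaleC_add_right: "c *\<^sub>C (x + y) = c *\<^sub>C x + c *\<^sub>C y"
    and scaleC_add_left: "(c + d) *\<^sub>C x = c *\<^sub>C x + d *\<^sub>C x"
    and scaleC_scaleC: "c *\<^sub>C d *\<^sub>C x = (c * d) *\<^sub>C x"
    and scaleC_of_real: "complex_of_real r *\<^sub>C x = r *\<^sub>R x"
    and cinner_commute: "cinner x y = cnj (cinner y x)"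
    and cinner_add_right: "cinner x (y + z) = cinner x y + cinner x z"
    and cinner_scaleC_right: "cinner x (c *\<^sub>C y) = c * cinner x y"
    and norm_cinner: "cinner x x = complex_of_real ((norm x)\<^sup>2)"

instantiation complex :: chilbert_space
begin

definition scaleC_complex :: "complex \<Rightarrow> complex \<Rightarrow> complex" where
  "scaleC_complex c x = c * x"

definition cinner_complex :: "complex \<Rightarrow> complex \<Rightarrow> complex" where
  "cinner_complex x y = cnj x * y"

instance
proof
  fix r :: real and c d x y z :: complex
  show "c *\<^sub>C (x + y) = c *\<^sub>C x + c *\<^sub>C y"
    and "(c + d) *\<^sub>C x = c *\<^sub>C x + d *\<^sub>C x"
    and "c *\<^sub>C d *\<^sub>C x = (c * d) *\<^sub>C x"
    and "cinner x (y + z) = cinner x y + cinner x z"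
    and "cinner x (c *\<^sub>C y) = c * cinner x y"
    and "cinner x y = cnj (cinner y x)"
    by (simp_all add: scaleC_complex_def cinner_complex_def ring_distribs ac_simps)
  show "complex_of_real r *\<^sub>C x = r *\<^sub>R x"
    by (simp add: scaleC_complex_def scaleR_conv_of_real)
  show "cinner x x = complex_of_real ((norm x)\<^sup>2)"
    unfolding cinner_complex_def using complex_norm_square[of x] by (metis mult.commute)
qed

end

definition bounded_clinear :: "('h::chilbert_space \<Rightarrow> 'h) \<Rightarrow> bool" where
  "bounded_clinear X \<longleftrightarrow> bounded_linear X \<and> (\<forall>c x. X (c *\<^sub>C x) = c *\<^sub>C X x)"

text \<open>The adjoint; it exists and is unique for every bounded complex-linear operator.\<close>

definition cadjoint :: "('h::chilbert_space \<Rightarrow> 'h) \<Rightarrow> 'h \<Rightarrow> 'h" where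
  "cadjoint X = (THE Y. \<forall>x y. cinner (Y x) y = cinner x (X y))"

definition unitary_op :: "('h::chilbert_space \<Rightarrow> 'h) \<Rightarrow> bool" where
  "unitary_op X \<longleftrightarrow> bounded_clinear X \<and> surj X \<and> (\<forall>x y. cinner (X x) (X y) = cinner x y)"

definition positive_op :: "('h::chilbert_space \<Rightarrow> 'h) \<Rightarrow> bool" where
  "positive_op X \<longleftrightarrow> bounded_clinear X \<and> (\<forall>x. cinner x (X x) \<in> \<real>\<^sub>\<ge>\<^sub>0)"

definition is_onb :: "'h::chilbert_space set \<Rightarrow> bool" where
  "is_onb B \<longleftrightarrow>
     (\<forall>e\<in>B. norm e = 1) \<and> (\<forall>e\<in>B. \<forall>f\<in>B. e \<noteq> f \<longrightarrow> cinner e f = 0) \<and>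
     (\<forall>x. (\<forall>e\<in>B. cinner e x = 0) \<longrightarrow> x = 0)"

text \<open>An arbitrary orthonormal basis. Neither the finiteness of the trace of a positive operator
  nor the trace of a trace-class operator depends on this choice.\<close>

definition onb :: "'h::chilbert_space set" where
  "onb = (SOME B. is_onb B)"

definition op_trace :: "('h::chilbert_space \<Rightarrow> 'h) \<Rightarrow> complex" where
  "op_trace X = (\<Sum>\<^sub>\<infinity>e\<in>onb. cinner e (X e))"

definition positive_finite_trace :: "('h::chilbert_space \<Rightarrow> 'h) \<Rightarrow> bool" where
  "positive_finite_trace P \<longleftrightarrow> positive_op P \<and> (\<lambda>e. cinner e (P e)) summable_on onb"

text \<open>The trace class is the complex linear span of the positive operators of finite trace. These
  form a convex cone, so that four of them suffice. If the space is finite-dimensional, all linear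
  operators are trace class.\<close>

definition trace_class :: "('h::chilbert_space \<Rightarrow> 'h) \<Rightarrow> bool" where
  "trace_class X \<longleftrightarrow>
     (\<exists>P Q R S. positive_finite_trace P \<and> positive_finite_trace Q \<and>
        positive_finite_trace R \<and> positive_finite_trace S \<and>
        X = (\<lambda>x. (P x - Q x) + \<i> *\<^sub>C (R x - S x)))"

definition density_op :: "('h::chilbert_space \<Rightarrow> 'h) \<Rightarrow> bool" where
  "density_op \<rho> \<longleftrightarrow> positive_finite_trace \<rho> \<and> op_trace \<rho> = 1"


section \<open>Quantum channels\<close>

text \<open>Channels act on trace-class operators, as the trace is not defined on all operators of an
  infinite-dimensional space; their values on other arguments are irrelevant.\<close>

definition linear_map :: "(('h::chilbert_space \<Rightarrow> 'h) \<Rightarrow> 'h \<Rightarrow> 'h) \<Rightarrow> bool" where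
  "linear_map E \<longleftrightarrow>
     (\<forall>X. trace_class X \<longrightarrow> trace_class (E X)) \<and>
     (\<forall>X Y. trace_class X \<longrightarrow> trace_class Y \<longrightarrow> E (\<lambda>x. X x + Y x) = (\<lambda>x. E X x + E Y x)) \<and>
     (\<forall>c X. trace_class X \<longrightarrow> E (\<lambda>x. c *\<^sub>C X x) = (\<lambda>x. c *\<^sub>C E X x))"

definition trace_preserving :: "(('h::chilbert_space \<Rightarrow> 'h) \<Rightarrow> 'h \<Rightarrow> 'h) \<Rightarrow> bool" where
  "trace_preserving E \<longleftrightarrow> (\<forall>X. trace_class X \<longrightarrow> op_trace (E X) = op_trace X)"

text \<open>Operators on \<open>\<complex>\<^sup>n \<otimes> \<H>\<close> are written as \<open>n \<times> n\<close> block matrices of operators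
  on \<open>\<H>\<close>, acting on \<open>n\<close>-tuples of vectors; \<open>id\<^sub>n \<otimes> \<E>\<close> then acts blockwise.\<close>

definition positive_block :: "nat \<Rightarrow> (nat \<Rightarrow> nat \<Rightarrow> 'h::chilbert_space \<Rightarrow> 'h) \<Rightarrow> bool" where
  "positive_block n X \<longleftrightarrow>
     (\<forall>\<xi>. (\<Sum>i<n. \<Sum>j<n. cinner (\<xi> i) (X i j (\<xi> j))) \<in> \<real>\<^sub>\<ge>\<^sub>0)"

definition completely_positive :: "(('h::chilbert_space \<Rightarrow> 'h) \<Rightarrow> 'h \<Rightarrow> 'h) \<Rightarrow> bool" where
  "completely_positive E \<longleftrightarrow>
     (\<forall>n X. (\<forall>i<n. \<forall>j<n. trace_class (X i j)) \<longrightarrow> positive_block n X \<longrightarrow>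
        positive_block n (\<lambda>i j. E (X i j)))"

definition quantum_channel :: "(('h::chilbert_space \<Rightarrow> 'h) \<Rightarrow> 'h \<Rightarrow> 'h) \<Rightarrow> bool" where
  "quantum_channel E \<longleftrightarrow> linear_map E \<and> trace_preserving E \<and> completely_positive E"


section \<open>Unitary representations and covariance\<close>

definition unitary_rep ::
  "('g, 'm) monoid_scheme \<Rightarrow> ('g \<Rightarrow> 'h::chilbert_space \<Rightarrow> 'h) \<Rightarrow> bool" where
  "unitary_rep G U \<longleftrightarrow>
     (\<forall>g\<in>carrier G. unitary_op (U g)) \<and>
     (\<forall>g\<in>carrier G. \<forall>h\<in>carrier G. U (g \<otimes>\<^bsub>G\<^esub> h) = U g \<circ> U h)"

definition strongly_continuous ::
  "'g topology \<Rightarrow> ('g \<Rightarrow> 'h::chilbert_space \<Rightarrow> 'h) \<Rightarrow> bool" where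
  "strongly_continuous T U \<longleftrightarrow> (\<forall>x. continuous_map T euclidean (\<lambda>g. U g x))"

definition conj_op ::
  "('g \<Rightarrow> 'h::chilbert_space \<Rightarrow> 'h) \<Rightarrow> 'g \<Rightarrow> ('h \<Rightarrow> 'h) \<Rightarrow> 'h \<Rightarrow> 'h" where
  "conj_op U g X = U g \<circ> X \<circ> cadjoint (U g)"

definition covariant ::
  "('g, 'm) monoid_scheme \<Rightarrow> ('g \<Rightarrow> 'h::chilbert_space \<Rightarrow> 'h) \<Rightarrow>
   (('h \<Rightarrow> 'h) \<Rightarrow> 'h \<Rightarrow> 'h) \<Rightarrow> bool" where
  "covariant G U E \<longleftrightarrow>
     (\<forall>g\<in>carrier G. \<forall>X. trace_class X \<longrightarrow> E (conj_op U g X) = conj_op U g (E X))"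

end

theory Submission
  imports Defs
begin

text \<open>For the nontrivial direction one averages a channel \<open>E\<close> as in (B) over the group:
  \<open>X \<mapsto> \<integral> U(g)\<^sup>\<dagger> E(U(g) X U(g)\<^sup>\<dagger>) U(g) dg\<close> is a covariant channel that maps \<open>\<rho>\<close> to \<open>\<sigma>\<close>.
  Instead of Haar measure, von Neumann's mean is used: the value of a continuous function on a compact
  group at which finite averages of its right translates, and those of its left translates,
  accumulate uniformly. The averaged operator is defined by its matrix elements, whose continuity in
  \<open>g\<close> follows by approximating \<open>X\<close> by finite-rank operators, and Dini's theorem shows that the trace
  may be exchanged with the mean. The facts needed about the trace, in particular that it does not
  depend on the orthonormal basis, come from a Cholesky decomposition of positive operators with respect
  to finitely many vectors, which avoids square roots and the spectral theorem. A finite group is a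
  compact group with its discrete topology.\<close>

section \<open>The invariant mean of a compact group\<close>

text \<open>Covariance of the average is the substitution of gh for g, so the mean has to be linear,
  positive, normalised and invariant under right translations. Limit values of right averages alone
  have no evident uniqueness, and additivity is not immediate since different functions call for
  different lists of points; left averages commute with right ones, and comparing the two pins the
  value down. The construction comes from the theory of almost periodic functions. The analytic
  obstacle is that \<open>U\<close> is only strongly continuous, that no continuity is assumed of
  the channel, and that the trace is an infinite sum. Two estimates take the place of a trace norm:
  the trace of a positive operator bounds all its matrix elements and is preserved by conjugation
  and by the channel, which makes errors uniform in g; and rank-one operators |v><w| are controlled
  through the positive block matrix built from v and w. In Dini's argument positivity yields the
  monotonicity, and trace preservation the constant limit.\<close>

definition list_avg :: "'a list \<Rightarrow> ('a \<Rightarrow> real) \<Rightarrow> real" where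
  "list_avg as f = (\<Sum>a\<leftarrow>as. f a) / real (length as)"

lemma list_avg_add: "list_avg as (\<lambda>a. f a + g a) = list_avg as f + list_avg as g"
  by (simp add: list_avg_def sum_list_addf add_divide_distrib)

lemma list_avg_cmult: "list_avg as (\<lambda>a. c * f a) = c * list_avg as f"
  by (simp add: list_avg_def sum_list_const_mult)

lemma list_avg_const: "as \<noteq> [] \<Longrightarrow> list_avg as (\<lambda>a. c) = c"
  by (simp add: list_avg_def sum_list_triv)

lemma list_avg_mono:
  assumes "\<And>a. a \<in> set as \<Longrightarrow> f a \<le> g a"
  shows "list_avg as f \<le> list_avg as g"
  unfolding list_avg_def by (intro divide_right_mono sum_list_mono assms) auto

lemma list_avg_cong:
  assumes "\<And>a. a \<in> set as \<Longrightarrow> f a = g a"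
  shows "list_avg as f = list_avg as g"
  by (intro order.antisym list_avg_mono) (simp_all add: assms)

lemma list_avg_near:
  assumes "as \<noteq> []" "\<And>a. a \<in> set as \<Longrightarrow> \<bar>f a - c\<bar> \<le> e"
  shows "\<bar>list_avg as f - c\<bar> \<le> e"
proof -
  have "list_avg as f \<le> list_avg as (\<lambda>a. c + e)"
    using assms(2) by (intro list_avg_mono) (fastforce simp: abs_le_iff)
  moreover have "list_avg as (\<lambda>a. c - e) \<le> list_avg as f"
    using assms(2) by (intro list_avg_mono) (fastforce simp: abs_le_iff)
  ultimately show ?thesis
    by (simp add: list_avg_const[OF assms(1)] abs_le_iff)
qed

lemma list_avg_map: "list_avg (map h as) f = list_avg as (\<lambda>a. f (h a))"
  by (simp add: list_avg_def comp_def)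

lemma list_avg_swap:
  "list_avg as (\<lambda>a. list_avg bs (\<lambda>b. f a b)) = list_avg bs (\<lambda>b. list_avg as (\<lambda>a. f a b))"
proof -
  have "(\<Sum>a\<leftarrow>as. \<Sum>b\<leftarrow>bs. f a b) = (\<Sum>b\<leftarrow>bs. \<Sum>a\<leftarrow>as. f a b)"
    by (induction as) (simp_all add: sum_list_addf)
  moreover have "list_avg as (\<lambda>a. list_avg bs (\<lambda>b. f a b))
      = (\<Sum>a\<leftarrow>as. \<Sum>b\<leftarrow>bs. f a b) / (length as * length bs)" for as bs and f :: "_ \<Rightarrow> _ \<Rightarrow> real"
    by (simp add: list_avg_def divide_inverse sum_list_mult_const)
  from this[of as bs f] this[of bs as "\<lambda>b a. f a b"] calculation show ?thesis
    by (simp add: mult.commute)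
qed

lemma list_avg_product:
  "list_avg (List.product as bs) (\<lambda>(a, b). f a b) = list_avg as (\<lambda>a. list_avg bs (f a))"
proof -
  have "(\<Sum>(a, b)\<leftarrow>List.product as bs. f a b) = (\<Sum>a\<leftarrow>as. \<Sum>b\<leftarrow>bs. f a b)"
    by (induction as) (simp_all add: comp_def)
  then show ?thesis
    by (simp add: list_avg_def divide_inverse sum_list_mult_const)
qed

section \<open>Continuous functions on a compact group\<close>

locale compact_group = group G for G :: "('g, 'm) monoid_scheme" (structure) +
  fixes T :: "'g topology"
  assumes topspace_eq: "topspace T = carrier G"
    and compact: "compact_space T"
    and continuous_mult: "continuous_map (prod_topology T T) T (\<lambda>(g, h). g \<otimes> h)"
    and continuous_inv: "continuous_map T T (\<lambda>g. inv g)"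
begin

abbreviation cont :: "('g \<Rightarrow> real) \<Rightarrow> bool" where
  "cont f \<equiv> continuous_map T euclideanreal f"

abbreviation points :: "'g list \<Rightarrow> bool" where
  "points as \<equiv> as \<noteq> [] \<and> set as \<subseteq> carrier G"

lemma cont_translate:
  assumes "continuous_map T Y f" and a: "a \<in> carrier G"
  shows "continuous_map T Y (\<lambda>x. f (x \<otimes> a))" "continuous_map T Y (\<lambda>x. f (a \<otimes> x))"
proof -
  have "continuous_map T (prod_topology T T) (\<lambda>x. (x, a))"
    "continuous_map T (prod_topology T T) (\<lambda>x. (a, x))"
    using a by (auto simp: topspace_eq continuous_map_pairedI)
  from this[THEN continuous_map_compose, OF continuous_mult, THEN continuous_map_compose, OF assms(1)]
  show "continuous_map T Y (\<lambda>x. f (x \<otimes> a))" "continuous_map T Y (\<lambda>x. f (a \<otimes> x))"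
    by (simp_all add: comp_def)
qed

lemma cont_avg:
  assumes "\<And>a. a \<in> set as \<Longrightarrow> cont (\<lambda>x. f x a)"
  shows "cont (\<lambda>x. list_avg as (f x))"
proof -
  have "cont (\<lambda>x. \<Sum>a\<leftarrow>as. f x a)"
    using assms by (induction as) (auto intro!: continuous_map_add)
  then show ?thesis
    unfolding list_avg_def divide_inverse by (intro continuous_map_real_mult) auto
qed

lemma cont_bounded:
  assumes "cont f"
  obtains K where "\<And>x. x \<in> carrier G \<Longrightarrow> \<bar>f x\<bar> \<le> K"
proof -
  have "compactin euclideanreal (f ` topspace T)"
    using image_compactin[OF _ assms] compact unfolding compact_space_def by blast
  then have "bounded (f ` carrier G)"
    by (simp add: topspace_eq compact_imp_bounded)
  then show ?thesis
    using that by (auto simp: bounded_iff)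
qed

text \<open>The tube lemma makes a continuous function left uniformly continuous; compactness then
  supplies a finite net of left translates.\<close>

lemma finite_translate_net:
  assumes "cont f" "e > 0"
  obtains cs where "points cs"
    "\<And>x. x \<in> carrier G \<Longrightarrow> \<exists>c\<in>set cs. \<forall>y\<in>carrier G. \<bar>f (x \<otimes> y) - f (c \<otimes> y)\<bar> < e"
proof -
  have "\<exists>V. openin T V \<and> c \<in> V \<and> (\<forall>x\<in>V. \<forall>y\<in>carrier G. \<bar>f (x \<otimes> y) - f (c \<otimes> y)\<bar> < e)"
    if c: "c \<in> carrier G" for c
  proof -
    let ?h = "\<lambda>z. f (fst z \<otimes> snd z) - f (c \<otimes> snd z)"
    have 1: "continuous_map (prod_topology T T) euclideanreal (\<lambda>z. f (fst z \<otimes> snd z))"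
      using continuous_map_compose[OF continuous_mult assms(1)] by (simp add: comp_def case_prod_unfold)
    have 2: "continuous_map (prod_topology T T) euclideanreal (\<lambda>z. f (c \<otimes> snd z))"
      using continuous_map_compose[OF continuous_map_snd cont_translate(2)[OF assms(1) c]]
      by (simp add: comp_def)
    have h: "continuous_map (prod_topology T T) euclideanreal ?h"
      using 1 2 by (rule continuous_map_diff)
    let ?W = "{z \<in> topspace (prod_topology T T). ?h z \<in> {-e<..<e}}"
    have "openin (prod_topology T T) ?W"
      using h by (rule openin_continuous_map_preimage) auto
    moreover have "compactin T (carrier G)"
      using compact by (simp add: compact_space_def topspace_eq)
    moreover have "{c} \<times> carrier G \<subseteq> ?W"
      using c assms(2) by (auto simp: topspace_eq)
    ultimately obtain V V' where "openin T V" "openin T V'" "c \<in> V" "carrier G \<subseteq> V'" "V \<times> V' \<subseteq> ?W"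
      using tube_lemma_right[of T T ?W "carrier G" c] c by (auto simp: topspace_eq)
    then show ?thesis
      by (intro exI[of _ V]) (force simp: abs_less_iff)
  qed
  then obtain V where V: "\<And>c. c \<in> carrier G \<Longrightarrow> openin T (V c)" "\<And>c. c \<in> carrier G \<Longrightarrow> c \<in> V c"
    "\<And>c x y. \<lbrakk>c \<in> carrier G; x \<in> V c; y \<in> carrier G\<rbrakk> \<Longrightarrow> \<bar>f (x \<otimes> y) - f (c \<otimes> y)\<bar> < e"
    by metis
  have "topspace T \<subseteq> \<Union>(V ` carrier G)" "\<forall>U\<in>V ` carrier G. openin T U"
    using V(1,2) by (auto simp: topspace_eq)
  then have "\<exists>\<F>. finite \<F> \<and> \<F> \<subseteq> V ` carrier G \<and> topspace T \<subseteq> \<Union>\<F>"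
    using compact by (simp add: compact_space_alt)
  then obtain C where C: "finite C" "C \<subseteq> carrier G" "carrier G \<subseteq> \<Union>(V ` C)"
    by (metis finite_subset_image topspace_eq)
  obtain cs where cs: "set cs = C"
    using C(1) finite_list by blast
  show ?thesis
  proof (rule that)
    show "points cs"
      using C cs one_closed by fastforce
    show "\<exists>c\<in>set cs. \<forall>y\<in>carrier G. \<bar>f (x \<otimes> y) - f (c \<otimes> y)\<bar> < e" if "x \<in> carrier G" for x
      using C V(3) that cs by (metis UN_E subsetD)
  qed
qed

section \<open>Averages of left and right translates\<close>

definition ravg :: "'g list \<Rightarrow> ('g \<Rightarrow> real) \<Rightarrow> 'g \<Rightarrow> real" where
  "ravg as f x = list_avg as (\<lambda>a. f (x \<otimes> a))"

definition lavg :: "'g list \<Rightarrow> ('g \<Rightarrow> real) \<Rightarrow> 'g \<Rightarrow> real" where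
  "lavg as f x = list_avg as (\<lambda>a. f (a \<otimes> x))"

definition near :: "real \<Rightarrow> ('g \<Rightarrow> real) \<Rightarrow> real \<Rightarrow> bool" where
  "near e f c \<longleftrightarrow> (\<forall>x\<in>carrier G. \<bar>f x - c\<bar> \<le> e)"

definition right_mean :: "('g \<Rightarrow> real) \<Rightarrow> real \<Rightarrow> bool" where
  "right_mean f c \<longleftrightarrow> (\<forall>e>0. \<exists>as. points as \<and> near e (ravg as f) c)"

definition left_mean :: "('g \<Rightarrow> real) \<Rightarrow> real \<Rightarrow> bool" where
  "left_mean f c \<longleftrightarrow> (\<forall>e>0. \<exists>as. points as \<and> near e (lavg as f) c)"

text \<open>Averaging over \<open>as\<close> and then over \<open>bs\<close> is averaging over all
  products \<open>b \<otimes> a\<close>. These may coincide; lists, unlike sets, count them with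
  multiplicity. One list \<open>cs\<close> serves every \<open>f\<close>, which
  \<open>mean_add\<close> relies on.\<close>

lemma ravg_ravg:
  assumes "points as" "points bs"
  obtains cs where "points cs" "\<And>f x. x \<in> carrier G \<Longrightarrow> ravg bs (ravg as f) x = ravg cs f x"
proof
  let ?cs = "map (\<lambda>(b, a). b \<otimes> a) (List.product bs as)"
  show "points ?cs"
    using assms by (cases as; cases bs) auto
  fix f x assume x: "x \<in> carrier G"
  have "ravg ?cs f x = list_avg (List.product bs as) (\<lambda>(b, a). f (x \<otimes> (b \<otimes> a)))"
    by (simp add: ravg_def list_avg_map case_prod_unfold)
  also have "\<dots> = list_avg bs (\<lambda>b. list_avg as (\<lambda>a. f (x \<otimes> (b \<otimes> a))))"
    by (rule list_avg_product)
  also have "\<dots> = ravg bs (ravg as f) x"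
    unfolding ravg_def using assms x by (intro list_avg_cong) (auto simp: m_assoc subset_iff)
  finally show "ravg bs (ravg as f) x = ravg ?cs f x" ..
qed

text \<open>Left and right translations commute by associativity, so the two finite sums may be
  exchanged.\<close>

lemma lavg_ravg:
  assumes "points as" "points bs" "x \<in> carrier G"
  shows "lavg bs (ravg as f) x = ravg as (lavg bs f) x"
proof -
  have "lavg bs (ravg as f) x = list_avg bs (\<lambda>b. list_avg as (\<lambda>a. f (b \<otimes> (x \<otimes> a))))"
    unfolding lavg_def ravg_def using assms by (intro list_avg_cong) (auto simp: m_assoc subset_iff)
  also have "\<dots> = ravg as (lavg bs f) x"
    unfolding lavg_def ravg_def by (rule list_avg_swap)
  finally show ?thesis .
qed

lemma near_ravg:
  assumes "points as" "near e f c"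
  shows "near e (ravg as f) c"
  using assms unfolding near_def ravg_def by (auto intro!: list_avg_near simp: subset_iff)

lemma near_lavg:
  assumes "points as" "near e f c"
  shows "near e (lavg as f) c"
  using assms unfolding near_def lavg_def by (auto intro!: list_avg_near simp: subset_iff)

text \<open>Averaging \<open>ravg as f\<close> from the left keeps it within d of c, averaging
  \<open>lavg bs f\<close> from the right keeps it within e of c', and the results agree; their
  common value at the unit is compared with both numbers.\<close>

lemma near_left_right:
  assumes "points as" "points bs" "near d (ravg as f) c" "near e (lavg bs f) c'"
  shows "\<bar>c - c'\<bar> \<le> d + e"
proof -
  have "\<bar>lavg bs (ravg as f) \<one> - c\<bar> \<le> d" "\<bar>ravg as (lavg bs f) \<one> - c'\<bar> \<le> e"
    using near_lavg[OF assms(2,3)] near_ravg[OF assms(1,4)] by (auto simp: near_def)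
  then show ?thesis
    using lavg_ravg[OF assms(1,2), of \<one> f] by simp
qed

text \<open>Since a continuous function also has a left mean, its right mean becomes unique in this
  way, as the description in \<open>mean\<close> requires.\<close>

lemma left_right_mean_unique:
  assumes "right_mean f c" "left_mean f c'"
  shows "c = c'"
proof -
  have "\<bar>c - c'\<bar> \<le> 0"
  proof (rule field_le_epsilon)
    fix e :: real assume "e > 0"
    then obtain as bs where "points as" "near (e/2) (ravg as f) c" "points bs" "near (e/2) (lavg bs f) c'"
      using assms unfolding right_mean_def left_mean_def by (meson half_gt_zero)
    then show "\<bar>c - c'\<bar> \<le> 0 + e"
      using near_left_right[of as bs "e/2" f c "e/2" c'] by simp
  qed
  then show ?thesis by simp
qed

text \<open>If every right average oscillated by at least \<open>s > 0\<close>, averaging an almost optimal one over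
  the points of a finite net, moved to a point where it is nearly minimal, would reduce its
  oscillation by a fixed amount.\<close>

lemma ravg_almost_constant:
  assumes f: "cont f" and "e > 0"
  shows "\<exists>as c. points as \<and> near e (ravg as f) c"
proof -
  \<comment> \<open>Upper bounds for the oscillation of right averages of \<open>f\<close>; their
    infimum \<open>s\<close> has to be 0.\<close>
  define S where "S = {d. \<exists>as m. points as \<and> (\<forall>x\<in>carrier G. m \<le> ravg as f x \<and> ravg as f x \<le> m + d)}"
  obtain K where K: "\<And>x. x \<in> carrier G \<Longrightarrow> \<bar>f x\<bar> \<le> K"
    using cont_bounded[OF f] by blast
  have "2 * K \<in> S"
    unfolding S_def using K
    by (auto intro!: exI[of _ "[\<one>]"] exI[of _ "-K"] simp: ravg_def list_avg_def abs_le_iff) fastforce+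
  have S0: "0 \<le> d" if "d \<in> S" for d
    using that one_closed unfolding S_def by force
  then have bdd: "bdd_below S"
    by (auto intro!: bdd_belowI[of _ 0])
  define s where "s = Inf S"
  have s_le: "s \<le> d" if "d \<in> S" for d
    unfolding s_def using bdd that by (rule cInf_lower[rotated])
  have s0: "0 \<le> s"
    unfolding s_def using S0 \<open>2 * K \<in> S\<close> by (intro cInf_greatest) auto
  have "s = 0"
  proof (rule ccontr)
    assume "s \<noteq> 0"
    then have s: "s > 0" using s0 by simp
    obtain cs where cs: "points cs"
      and net: "\<And>x. x \<in> carrier G \<Longrightarrow> \<exists>c\<in>set cs. \<forall>y\<in>carrier G. \<bar>f (x \<otimes> y) - f (c \<otimes> y)\<bar> < s / 4"
      using finite_translate_net[OF f, of "s / 4"] s by auto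
    define N where "N = real (length cs)"
    have N: "N > 0" using cs by (simp add: N_def)
    \<comment> \<open>Each entry of the minimum serves one contradiction with the choice of
      \<open>s\<close>: \<open>s / 4\<close> where the average is shown to drop below
      \<open>m + s / 4\<close>, and \<open>s / (2 * N)\<close> where the oscillation is finally
      reduced to \<open>d - s / (2 * N)\<close>.\<close>
    define r where "r = min (s / 4) (s / (2 * N))"
    have r: "r > 0" using s N by (simp add: r_def)
    obtain d where d: "d \<in> S" "d < s + r"
      using cInf_lessD[of S "s + r"] \<open>2 * K \<in> S\<close> r unfolding s_def by auto
    then obtain as m where as: "points as"
      and m: "\<And>x. x \<in> carrier G \<Longrightarrow> m \<le> ravg as f x \<and> ravg as f x \<le> m + d"
      unfolding S_def by auto
    have "\<exists>y\<in>carrier G. ravg as f y < m + s / 4"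
    proof (rule ccontr)
      assume "\<not> ?thesis"
      then have "d - s / 4 \<in> S"
        unfolding S_def using as m by (force intro!: exI[of _ as] exI[of _ "m + s / 4"])
      then show False
        using s_le[of "d - s / 4"] d by (simp add: r_def)
    qed
    then obtain y where y: "y \<in> carrier G" "ravg as f y < m + s / 4" by blast
    \<comment> \<open>If \<open>c\<close> is the net point belonging to \<open>x\<close>, then
      \<open>x \<otimes> (inv c \<otimes> y)\<close> behaves like
      \<open>c \<otimes> (inv c \<otimes> y) = y\<close>, where the average is low. So at every
      \<open>x\<close> at least one of the N summands is at most \<open>m + s / 2\<close>, hence at
      most \<open>m + d - s / 2\<close> as \<open>s \<le> d\<close>.\<close>
    define bs where "bs = map (\<lambda>c. inv c \<otimes> y) cs"
    have bs: "points bs"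
      using cs y by (auto simp: bs_def)
    have low: "m \<le> ravg bs (ravg as f) x" if "x \<in> carrier G" for x
    proof -
      have "list_avg bs (\<lambda>a. m) \<le> ravg bs (ravg as f) x"
        unfolding ravg_def[of bs] using m bs that by (intro list_avg_mono) (auto simp: subset_iff)
      then show ?thesis using bs by (simp add: list_avg_const)
    qed
    have up: "ravg bs (ravg as f) x \<le> m + (d - s / (2 * N))" if x: "x \<in> carrier G" for x
    proof -
      obtain c where c: "c \<in> set cs"
        and near: "\<And>y. y \<in> carrier G \<Longrightarrow> \<bar>f (x \<otimes> y) - f (c \<otimes> y)\<bar> < s / 4"
        using net[OF x] by blast
      have cG: "c \<in> carrier G" using c cs by blast
      define b where "b = inv c \<otimes> y"
      have bG: "b \<in> carrier G" using cG y by (simp add: b_def)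
      have cb: "c \<otimes> b = y" using cG y by (simp add: b_def m_assoc[symmetric])
      have "\<bar>ravg as (\<lambda>z. f (x \<otimes> z) - f (c \<otimes> z)) b - 0\<bar> \<le> s / 4"
        unfolding ravg_def using as near bG by (intro list_avg_near) (auto simp: less_imp_le subset_iff)
      moreover have "ravg as f (x \<otimes> b) = ravg as f y + ravg as (\<lambda>z. f (x \<otimes> z) - f (c \<otimes> z)) b"
        unfolding ravg_def list_avg_add[symmetric] cb[symmetric]
        using as x cG bG by (intro list_avg_cong) (auto simp: m_assoc subset_iff)
      ultimately have "ravg as f (x \<otimes> b) \<le> m + s / 2"
        using y(2) by simp
      moreover have "s \<le> d" using s_le d(1) .
      ultimately have 1: "ravg as f (x \<otimes> b) \<le> m + d - s / 2" by simp
      have upper: "ravg as f (x \<otimes> (inv c' \<otimes> y)) \<le> m + d" if "c' \<in> set cs" for c'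
        using m cs that x y by auto
      \<comment> \<open>Isolates the one low summand; all others are bounded by
        \<open>m + d\<close>.\<close>
      obtain cs1 cs2 where split: "cs = cs1 @ c # cs2"
        using c by (meson split_list)
      have "(\<Sum>c'\<leftarrow>cs1. ravg as f (x \<otimes> (inv c' \<otimes> y))) \<le> (\<Sum>c'\<leftarrow>cs1. m + d)"
        "(\<Sum>c'\<leftarrow>cs2. ravg as f (x \<otimes> (inv c' \<otimes> y))) \<le> (\<Sum>c'\<leftarrow>cs2. m + d)"
        using upper by (auto intro!: sum_list_mono simp: split)
      then have "(\<Sum>c'\<leftarrow>cs. ravg as f (x \<otimes> (inv c' \<otimes> y))) \<le> N * (m + d) - s / 2"
        using 1 by (simp add: split N_def sum_list_triv b_def algebra_simps)
      then have "ravg bs (ravg as f) x \<le> (N * (m + d) - s / 2) / N"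
        unfolding ravg_def[of bs] unfolding bs_def list_avg_map list_avg_def[of cs] N_def
        by (rule divide_right_mono) simp
      also have "\<dots> = m + (d - s / (2 * N))"
        using N by (simp add: field_simps)
      finally show ?thesis .
    qed
    obtain cs' where "points cs'" "\<And>f x. x \<in> carrier G \<Longrightarrow> ravg bs (ravg as f) x = ravg cs' f x"
      using ravg_ravg[OF as bs] by blast
    then have "d - s / (2 * N) \<in> S"
      unfolding S_def using low up by (auto intro!: exI[of _ cs'] exI[of _ m])
    then show False
      using s_le[of "d - s / (2 * N)"] d by (simp add: r_def)
  qed
  then obtain d where "d \<in> S" "d < e"
    using cInf_lessD[of S e] \<open>2 * K \<in> S\<close> \<open>e > 0\<close> unfolding s_def by auto
  then obtain as m where "points as" "\<forall>x\<in>carrier G. m \<le> ravg as f x \<and> ravg as f x \<le> m + d"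
    unfolding S_def by auto
  with \<open>d < e\<close> have "points as" "near e (ravg as f) m"
    unfolding near_def by force+
  then show ?thesis by blast
qed

text \<open>Inversion of the group turns right translates into left ones.\<close>

lemma lavg_almost_constant:
  assumes f: "cont f" and "e > 0"
  shows "\<exists>as c. points as \<and> near e (lavg as f) c"
proof -
  have "cont (\<lambda>x. f (inv x))"
    using continuous_map_compose[OF continuous_inv f] by (simp add: comp_def)
  then obtain as c where as: "points as" "near e (ravg as (\<lambda>x. f (inv x))) c"
    using ravg_almost_constant[OF _ \<open>e > 0\<close>] by blast
  have "lavg (map (\<lambda>a. inv a) as) f x = ravg as (\<lambda>x. f (inv x)) (inv x)" if "x \<in> carrier G" for x
    unfolding lavg_def ravg_def list_avg_map
    using as that by (intro list_avg_cong) (auto simp: inv_mult_group subset_iff)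
  then have "near e (lavg (map (\<lambda>a. inv a) as) f) c"
    using as unfolding near_def by simp
  then show ?thesis
    using as by (intro exI[of _ "map (\<lambda>a. inv a) as"] exI[of _ c]) auto
qed

text \<open>Values \<open>c n\<close> of right averages are compared with one another only through
  values \<open>d m\<close> of left averages. This makes them a Cauchy sequence and gives both kinds
  the same limit.\<close>

lemma mean_exists:
  assumes f: "cont f"
  obtains c where "right_mean f c" "left_mean f c"
proof -
  have "\<exists>as c. points as \<and> near (inverse (Suc n)) (ravg as f) c" for n
    by (rule ravg_almost_constant[OF f]) simp
  then obtain as c where as: "\<And>n. points (as n)" "\<And>n. near (inverse (Suc n)) (ravg (as n) f) (c n)"
    by metis
  have "\<exists>as c. points as \<and> near (inverse (Suc n)) (lavg as f) c" for n
    by (rule lavg_almost_constant[OF f]) simp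
  then obtain bs d where bs: "\<And>n. points (bs n)" "\<And>n. near (inverse (Suc n)) (lavg (bs n) f) (d n)"
    by metis
  have cd: "\<bar>c n - d m\<bar> \<le> inverse (Suc n) + inverse (Suc m)" for n m
    by (rule near_left_right[OF as(1) bs(1) as(2) bs(2)])
  have small: "\<exists>n. inverse (Suc n) < e" if "e > 0" for e :: real
    using reals_Archimedean that by blast
  have "Cauchy c"
  proof (rule metric_CauchyI)
    fix e :: real assume "e > 0"
    \<comment> \<open>Passing from \<open>c m\<close> to \<open>c n\<close> by way of
      \<open>d M\<close> costs four terms, each at most \<open>inverse (Suc M)\<close>.\<close>
    then obtain M where M: "inverse (Suc M) < e / 4" using small[of "e/4"] by auto
    show "\<exists>M. \<forall>m\<ge>M. \<forall>n\<ge>M. dist (c m) (c n) < e"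
    proof (intro exI[of _ M] allI impI)
      fix m n assume "M \<le> m" "M \<le> n"
      then have "inverse (real (Suc m)) \<le> inverse (Suc M)" "inverse (real (Suc n)) \<le> inverse (Suc M)"
        by (simp_all add: field_simps)
      then show "dist (c m) (c n) < e"
        using cd[of m M] cd[of n M] M unfolding dist_real_def by linarith
    qed
  qed
  then obtain l where l: "c \<longlonglongrightarrow> l"
    using Cauchy_convergent convergent_def by blast
  have dl: "\<bar>l - d m\<bar> \<le> inverse (Suc m)" for m
  proof (rule LIMSEQ_le)
    show "(\<lambda>n. \<bar>c n - d m\<bar>) \<longlonglongrightarrow> \<bar>l - d m\<bar>"
      using l by (intro tendsto_intros)
    show "(\<lambda>n. inverse (real (Suc n)) + inverse (Suc m)) \<longlonglongrightarrow> inverse (Suc m)"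
      using tendsto_add[OF LIMSEQ_inverse_real_of_nat tendsto_const] by simp
  qed (use cd in blast)
  show ?thesis
  proof
    show "right_mean f l"
      unfolding right_mean_def
    proof (intro allI impI)
      fix e :: real assume "e > 0"
      \<comment> \<open>One term for the average against \<open>c n\<close>, two for
        \<open>c n\<close> against \<open>d n\<close>, one for \<open>d n\<close> against
        \<open>l\<close>.\<close>
      then obtain n where n: "inverse (Suc n) < e / 4" using small[of "e/4"] by auto
      then have "near e (ravg (as n) f) l"
        using as(2)[of n] cd[of n n] dl[of n] unfolding near_def by fastforce
      with as(1) show "\<exists>as. points as \<and> near e (ravg as f) l" by blast
    qed
    show "left_mean f l"
      unfolding left_mean_def
    proof (intro allI impI)
      fix e :: real assume "e > 0"
      then obtain n where n: "inverse (Suc n) < e / 4" using small[of "e/4"] by auto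
      then have "near e (lavg (bs n) f) l"
        using bs(2)[of n] dl[of n] unfolding near_def by fastforce
      with bs(1) show "\<exists>as. points as \<and> near e (lavg as f) l" by blast
    qed
  qed
qed

section \<open>Linearity, positivity and invariance of the mean\<close>

definition mean :: "('g \<Rightarrow> real) \<Rightarrow> real" where
  "mean f = (THE c. right_mean f c)"

lemma mean_eqI:
  assumes "cont f" "right_mean f c"
  shows "mean f = c"
  unfolding mean_def
proof (rule the_equality)
  fix c' assume "right_mean f c'"
  moreover obtain l where "left_mean f l" using mean_exists[OF assms(1)] by blast
  ultimately show "c' = c"
    using left_right_mean_unique assms(2) by blast
qed (rule assms(2))

lemma right_mean_mean:
  assumes "cont f"
  shows "right_mean f (mean f)"
  using mean_exists[OF assms] mean_eqI[OF assms] by metis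

lemma cont_ravg: "cont f \<Longrightarrow> points as \<Longrightarrow> cont (ravg as f)"
  unfolding ravg_def by (intro cont_avg cont_translate) auto

text \<open>Right averages of \<open>ravg as f\<close> are themselves right averages of
  \<open>f\<close>, so they approach a right mean of \<open>f\<close>. For a single point this is
  right invariance.\<close>

lemma mean_ravg:
  assumes "cont f" "points as"
  shows "mean (ravg as f) = mean f"
proof (rule mean_eqI[symmetric, OF assms(1)], unfold right_mean_def, intro allI impI)
  fix e :: real assume "e > 0"
  then obtain bs where bs: "points bs" "near e (ravg bs (ravg as f)) (mean (ravg as f))"
    using right_mean_mean[OF cont_ravg[OF assms]] unfolding right_mean_def by blast
  obtain cs where "points cs" "\<And>f x. x \<in> carrier G \<Longrightarrow> ravg bs (ravg as f) x = ravg cs f x"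
    using ravg_ravg[OF assms(2) bs(1)] by blast
  then show "\<exists>cs. points cs \<and> near e (ravg cs f) (mean (ravg as f))"
    using bs unfolding near_def by auto
qed

lemma mean_translate:
  assumes "cont f" "a \<in> carrier G"
  shows "mean (\<lambda>x. f (x \<otimes> a)) = mean f"
  using mean_ravg[OF assms(1), of "[a]"] assms(2) by (simp add: ravg_def[abs_def] list_avg_def)

text \<open>The points that serve \<open>f\<close> need not serve \<open>g\<close>. A further
  average of \<open>ravg as g\<close> settles \<open>g\<close>, whose mean \<open>mean_ravg\<close>
  keeps, while it leaves \<open>ravg as f\<close> near its mean.\<close>

lemma mean_add:
  assumes f: "cont f" and g: "cont g"
  shows "mean (\<lambda>x. f x + g x) = mean f + mean g"
proof (rule mean_eqI, rule continuous_map_add[OF f g], unfold right_mean_def, intro allI impI)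
  fix e :: real assume e: "e > 0"
  then obtain as where as: "points as" "near (e/2) (ravg as f) (mean f)"
    using right_mean_mean[OF f] unfolding right_mean_def by (meson half_gt_zero)
  obtain bs where bs: "points bs" "near (e/2) (ravg bs (ravg as g)) (mean (ravg as g))"
    using right_mean_mean[OF cont_ravg[OF g as(1)]] e unfolding right_mean_def by (meson half_gt_zero)
  note b2 = bs(2)[unfolded mean_ravg[OF g as(1)]]
  have b1: "near (e/2) (ravg bs (ravg as f)) (mean f)"
    using near_ravg[OF bs(1) as(2)] .
  obtain cs where cs: "points cs" "\<And>f x. x \<in> carrier G \<Longrightarrow> ravg bs (ravg as f) x = ravg cs f x"
    using ravg_ravg[OF as(1) bs(1)] by blast
  have "near e (ravg cs (\<lambda>x. f x + g x)) (mean f + mean g)"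
    unfolding near_def
  proof
    fix x assume x: "x \<in> carrier G"
    have "ravg cs (\<lambda>x. f x + g x) x = ravg cs f x + ravg cs g x"
      by (simp add: ravg_def list_avg_add)
    then show "\<bar>ravg cs (\<lambda>x. f x + g x) x - (mean f + mean g)\<bar> \<le> e"
      using bspec[OF b1[unfolded near_def] x] bspec[OF b2[unfolded near_def] x] cs(2)[OF x, of f] cs(2)[OF x, of g]
      by (simp only: abs_le_iff) linarith
  qed
  with cs(1) show "\<exists>as. points as \<and> near e (ravg as (\<lambda>x. f x + g x)) (mean f + mean g)" by blast
qed

lemma mean_const: "mean (\<lambda>x. c) = c"
proof (rule mean_eqI)
  show "right_mean (\<lambda>x. c) c"
    unfolding right_mean_def near_def
    by (auto intro!: exI[of _ "[\<one>]"] simp: ravg_def list_avg_def)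
qed simp

lemma mean_cmult:
  assumes f: "cont f"
  shows "mean (\<lambda>x. c * f x) = c * mean f"
proof (rule mean_eqI)
  show "right_mean (\<lambda>x. c * f x) (c * mean f)"
    unfolding right_mean_def
  proof (intro allI impI)
    fix e :: real assume e: "e > 0"
    then have "e / (\<bar>c\<bar> + 1) > 0" by simp
    then obtain as where as: "points as" "near (e / (\<bar>c\<bar> + 1)) (ravg as f) (mean f)"
      using right_mean_mean[OF f] unfolding right_mean_def by meson
    have "near e (ravg as (\<lambda>x. c * f x)) (c * mean f)"
      unfolding near_def
    proof
      fix x assume x: "x \<in> carrier G"
      have "\<bar>c * ravg as f x - c * mean f\<bar> = \<bar>c\<bar> * \<bar>ravg as f x - mean f\<bar>"
        by (simp add: abs_mult[symmetric] algebra_simps)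
      also have "\<dots> \<le> \<bar>c\<bar> * (e / (\<bar>c\<bar> + 1))"
        using as(2) x by (intro mult_left_mono) (auto simp: near_def)
      also have "\<dots> \<le> e"
        using e by (simp add: field_simps)
      finally show "\<bar>ravg as (\<lambda>x. c * f x) x - c * mean f\<bar> \<le> e"
        by (simp add: ravg_def list_avg_cmult)
    qed
    with as(1) show "\<exists>as. points as \<and> near e (ravg as (\<lambda>x. c * f x)) (c * mean f)" by blast
  qed
qed (use f in \<open>intro continuous_map_real_mult; simp\<close>)

lemma mean_lower:
  assumes f: "cont f" and "\<And>x. x \<in> carrier G \<Longrightarrow> c \<le> f x"
  shows "c \<le> mean f"
proof (rule field_le_epsilon)
  fix e :: real assume "e > 0"
  then obtain as where as: "points as" "near e (ravg as f) (mean f)"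
    using right_mean_mean[OF f] unfolding right_mean_def by blast
  have "list_avg as (\<lambda>a. c) \<le> ravg as f \<one>"
    unfolding ravg_def using as assms(2) by (intro list_avg_mono) (auto simp: subset_iff)
  moreover have "\<bar>ravg as f \<one> - mean f\<bar> \<le> e"
    using as(2) by (simp add: near_def)
  ultimately show "c \<le> mean f + e"
    using as(1) by (simp add: list_avg_const)
qed

text \<open>Functions such as \<open>form\<close> are controlled on the carrier only, so identities
  between them hold only there.\<close>

lemma mean_cong:
  assumes "cont f" "\<And>x. x \<in> carrier G \<Longrightarrow> f x = g x"
  shows "mean f = mean g"
proof -
  have "cont g"
    using assms by (intro continuous_map_eq[of T _ f g]) (auto simp: topspace_eq)
  moreover have "ravg as f x = ravg as g x" if "points as" "x \<in> carrier G" for as x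
    unfolding ravg_def using that assms(2) by (intro list_avg_cong) auto
  then have "right_mean g (mean f)"
    using right_mean_mean[OF assms(1)] unfolding right_mean_def near_def by metis
  ultimately show ?thesis
    using mean_eqI by simp
qed

section \<open>The mean of complex functions\<close>

definition cmean :: "('g \<Rightarrow> complex) \<Rightarrow> complex" where
  "cmean f = Complex (mean (\<lambda>x. Re (f x))) (mean (\<lambda>x. Im (f x)))"

abbreviation ccont :: "('g \<Rightarrow> complex) \<Rightarrow> bool" where
  "ccont f \<equiv> continuous_map T euclidean f"

lemma ccont_Re: "ccont f \<Longrightarrow> cont (\<lambda>x. Re (f x))"
  and ccont_Im: "ccont f \<Longrightarrow> cont (\<lambda>x. Im (f x))"
  by (simp_all add: continuous_map_atin tendsto_Re tendsto_Im)

lemma ccont_add: "ccont f \<Longrightarrow> ccont g \<Longrightarrow> ccont (\<lambda>x. f x + g x)"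
  and ccont_cmult: "ccont f \<Longrightarrow> ccont (\<lambda>x. c * f x)"
  by (auto simp: continuous_map_atin intro: tendsto_intros)

lemma ccont_sum:
  "(\<And>i. i \<in> I \<Longrightarrow> ccont (f i)) \<Longrightarrow> ccont (\<lambda>x. \<Sum>i\<in>I. f i x)"
  by (auto simp: continuous_map_atin intro: tendsto_sum)

lemma cmean_cong:
  assumes "ccont f" "\<And>x. x \<in> carrier G \<Longrightarrow> f x = g x"
  shows "cmean f = cmean g"
  using mean_cong[OF ccont_Re[OF assms(1)], of "\<lambda>x. Re (g x)"]
    mean_cong[OF ccont_Im[OF assms(1)], of "\<lambda>x. Im (g x)"] assms(2)
  by (simp add: cmean_def)

lemma cmean_const: "cmean (\<lambda>x. c) = c"
  by (simp add: cmean_def mean_const)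

lemma cmean_add: "ccont f \<Longrightarrow> ccont g \<Longrightarrow> cmean (\<lambda>x. f x + g x) = cmean f + cmean g"
  by (simp add: cmean_def mean_add ccont_Re ccont_Im complex_eq_iff)

lemma cmean_cmult:
  assumes "ccont f"
  shows "cmean (\<lambda>x. c * f x) = c * cmean f"
proof -
  have *: "cont (\<lambda>x. r * Re (f x))" "cont (\<lambda>x. r * Im (f x))" for r
    using ccont_Re[OF assms] ccont_Im[OF assms] by (intro continuous_map_real_mult; simp)+
  have "mean (\<lambda>x. Re c * Re (f x) + (- Im c) * Im (f x))
      = Re c * mean (\<lambda>x. Re (f x)) + (- Im c) * mean (\<lambda>x. Im (f x))"
    unfolding mean_add[OF *] mean_cmult[OF ccont_Re[OF assms]] mean_cmult[OF ccont_Im[OF assms]] ..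
  moreover have "mean (\<lambda>x. Re c * Im (f x) + Im c * Re (f x))
      = Re c * mean (\<lambda>x. Im (f x)) + Im c * mean (\<lambda>x. Re (f x))"
    unfolding mean_add[OF *(2,1)] mean_cmult[OF ccont_Re[OF assms]] mean_cmult[OF ccont_Im[OF assms]] ..
  ultimately show ?thesis
    by (simp add: cmean_def complex_eq_iff)
qed

lemma cmean_sum:
  "finite I \<Longrightarrow> (\<And>i. i \<in> I \<Longrightarrow> ccont (f i)) \<Longrightarrow> cmean (\<lambda>x. \<Sum>i\<in>I. f i x) = (\<Sum>i\<in>I. cmean (f i))"
  by (induction I rule: finite_induct) (simp_all add: cmean_const cmean_add ccont_sum)

lemma cmean_translate:
  assumes "ccont f" "a \<in> carrier G"
  shows "cmean (\<lambda>x. f (x \<otimes> a)) = cmean f"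
  using mean_translate[OF ccont_Re[OF assms(1)] assms(2)]
    mean_translate[OF ccont_Im[OF assms(1)] assms(2)]
  by (simp add: cmean_def)

lemma cmean_nonneg:
  assumes "ccont f" "\<And>x. x \<in> carrier G \<Longrightarrow> f x \<in> \<real>\<^sub>\<ge>\<^sub>0"
  shows "cmean f \<in> \<real>\<^sub>\<ge>\<^sub>0"
proof -
  have "mean (\<lambda>x. Im (f x)) = mean (\<lambda>x. 0)"
    using assms by (intro mean_cong ccont_Im) (auto simp: complex_nonneg_Reals_iff)
  moreover have "0 \<le> mean (\<lambda>x. Re (f x))"
    using assms by (intro mean_lower ccont_Re) (auto simp: complex_nonneg_Reals_iff)
  ultimately show ?thesis
    by (simp add: cmean_def complex_nonneg_Reals_iff mean_const)
qed

lemma Re_cmean_lower: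
  "ccont f \<Longrightarrow> (\<And>x. x \<in> carrier G \<Longrightarrow> c \<le> Re (f x)) \<Longrightarrow> c \<le> Re (cmean f)"
  by (simp add: cmean_def mean_lower ccont_Re)

lemma Re_cmean_upper:
  assumes "ccont f" "\<And>x. x \<in> carrier G \<Longrightarrow> Re (f x) \<le> c"
  shows "Re (cmean f) \<le> c"
  using Re_cmean_lower[OF ccont_cmult[OF assms(1), of "-1"], of "- c"] assms(2)
    cmean_cmult[OF assms(1), of "-1"] by simp

lemma mean_bound:
  assumes "cont f" "\<And>x. x \<in> carrier G \<Longrightarrow> \<bar>f x\<bar> \<le> K"
  shows "\<bar>mean f\<bar> \<le> K"
proof -
  have "-K \<le> mean f"
    using assms(2) by (intro mean_lower assms(1)) (fastforce simp: abs_le_iff)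
  moreover have "-K \<le> mean (\<lambda>x. -1 * f x)"
    using assms by (intro mean_lower continuous_map_real_mult) (auto simp: abs_le_iff)
  ultimately show ?thesis
    using mean_cmult[OF assms(1), of "-1"] by (simp add: abs_le_iff)
qed

text \<open>The factor 2 comes from bounding real and imaginary parts separately; any constant will
  do for \<open>form_operator\<close>.\<close>

lemma cmod_cmean_le:
  assumes "ccont f" "\<And>x. x \<in> carrier G \<Longrightarrow> cmod (f x) \<le> K"
  shows "cmod (cmean f) \<le> 2 * K"
proof -
  have "\<bar>Re (cmean f)\<bar> \<le> K"
    using mean_bound[OF ccont_Re[OF assms(1)]] assms(2) abs_Re_le_cmod order_trans
    by (simp add: cmean_def) blast
  moreover have "\<bar>Im (cmean f)\<bar> \<le> K"
    using mean_bound[OF ccont_Im[OF assms(1)]] assms(2) abs_Im_le_cmod order_trans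
    by (simp add: cmean_def) blast
  ultimately show ?thesis
    using cmod_le[of "cmean f"] by simp
qed

end


section \<open>Hilbert space geometry\<close>

lemma cinner_add_left: "cinner (x + y) z = cinner x z + cinner y z"
  by (simp add: cinner_commute[of _ z] cinner_add_right)

lemma cinner_scaleC_left: "cinner (c *\<^sub>C x) y = cnj c * cinner x y"
  by (simp add: cinner_commute[of _ y] cinner_scaleC_right)

lemma scaleC_zero_left: "0 *\<^sub>C x = 0"
  and scaleC_one: "1 *\<^sub>C x = x"
  using scaleC_of_real[of 0 x] scaleC_of_real[of 1 x] by simp_all

lemma scaleC_zero_right: "c *\<^sub>C 0 = 0"
  using scaleC_add_right[of c 0 0] by simp

lemma scaleC_minus_left: "(- c) *\<^sub>C x = - (c *\<^sub>C x)"
  using minus_unique[of "c *\<^sub>C x" "(- c) *\<^sub>C x"] scaleC_add_left[of c "- c" x]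
  by (simp add: scaleC_zero_left)

lemma scaleC_minus_right: "c *\<^sub>C (- x) = - (c *\<^sub>C x)"
  using minus_unique[of "c *\<^sub>C x" "c *\<^sub>C (- x)"] scaleC_add_right[of c x "- x"]
  by (simp add: scaleC_zero_right)

lemma scaleC_diff_left: "(c - d) *\<^sub>C x = c *\<^sub>C x - d *\<^sub>C x"
  using scaleC_add_left[of c "- d" x] by (simp add: scaleC_minus_left)

lemma scaleC_diff_right: "c *\<^sub>C (x - y) = c *\<^sub>C x - c *\<^sub>C y"
  using scaleC_add_right[of c x "- y"] by (simp add: scaleC_minus_right)

lemma norm_scaleC: "norm (c *\<^sub>C x) = cmod c * norm x"
proof -
  have "cinner (c *\<^sub>C x) (c *\<^sub>C x) = complex_of_real ((cmod c * norm x)\<^sup>2)"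
    unfolding cinner_scaleC_left cinner_scaleC_right power_mult_distrib of_real_mult
      complex_norm_square[of c] norm_cinner[of x] by (simp only: ac_simps)
  then have "(norm (c *\<^sub>C x))\<^sup>2 = (cmod c * norm x)\<^sup>2"
    unfolding norm_cinner of_real_eq_iff .
  then show ?thesis
    by (rule power2_eq_imp_eq) simp_all
qed

text \<open>The criterion for a nonnegative two by two form, stated for four unrelated numbers so
  that it applies both to a single positive operator and to the entries of a block matrix of
  operators.\<close>

lemma nonneg_form2:
  fixes a b c d :: complex
  assumes "\<And>s t. cnj s * s * a + cnj s * t * b + cnj t * s * c + cnj t * t * d \<in> \<real>\<^sub>\<ge>\<^sub>0"
  shows nonneg_form2_cnj: "c = cnj b" and nonneg_form2_le: "(cmod b)\<^sup>2 \<le> Re a * Re d"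
proof -
  have a: "Re a \<ge> 0" "Im a = 0" and d: "Re d \<ge> 0" "Im d = 0"
    using assms[of 1 0] assms[of 0 1] by (auto simp: complex_nonneg_Reals_iff)
  show c: "c = cnj b"
    \<comment> \<open>Polarization: the value at (1, 1) makes \<open>Im (b + c)\<close> vanish, the
      one at (1, \<i>) gives \<open>Re b = Re c\<close>.\<close>
    using assms[of 1 1] assms[of 1 \<i>] a d by (auto simp: complex_nonneg_Reals_iff complex_eq_iff)
  define N where "N = (cmod b)\<^sup>2"
  have N: "complex_of_real N = b * cnj b"
    unfolding N_def by (rule complex_norm_square)
  \<comment> \<open>Choosing t as a real multiple of \<open>- cnj b\<close> aligns the phases and
    leaves a real quadratic form in r and k.\<close>
  have key: "r\<^sup>2 * Re a - 2 * r * k * N + k\<^sup>2 * N * Re d \<ge> 0" for r k :: real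
  proof -
    have eq: "cnj r * r * a + cnj r * (- cnj b * k) * b + cnj (- cnj b * k) * r * c
        + cnj (- cnj b * k) * (- cnj b * k) * d
      = r * r * a - 2 * r * k * N + k * k * N * d"
      by (simp add: N c algebra_simps)
    have "Re (r * r * a - 2 * r * k * N + k * k * N * d) \<ge> 0"
      using assms[of r "- cnj b * k"] unfolding eq complex_nonneg_Reals_iff ..
    then show ?thesis
      by (simp add: power2_eq_square)
  qed
  show "(cmod b)\<^sup>2 \<le> Re a * Re d"
  proof (cases "N = 0")
    case True
    then show ?thesis using a d by (simp add: N_def)
  next
    case False
    then have Npos: "N > 0" by (simp add: N_def)
    \<comment> \<open>With \<open>Re a = 0\<close> the choice r = Re d + 1, k = 1 would make the
      quadratic negative. Then r = N, k = Re a gives the claim multiplied by the positive number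
      \<open>Re a * N\<close>.\<close>
    have "Re a > 0"
    proof (rule ccontr)
      assume "\<not> Re a > 0"
      then have "Re a = 0" using a by simp
      then have "N * (2 * (Re d + 1)) \<le> N * Re d"
        using key[of "Re d + 1" 1] by (simp add: algebra_simps)
      then show False using Npos d by (simp add: mult_le_cancel_left)
    qed
    moreover have "Re a * N * (Re a * Re d - N) \<ge> 0"
      using key[of N "Re a"] by (simp add: power2_eq_square algebra_simps)
    ultimately have "Re a * Re d - N \<ge> 0"
      using Npos by (metis mult_pos_pos not_le mult_less_0_iff order_less_asym)
    then show ?thesis by (simp add: N_def)
  qed
qed

section \<open>Positive operators and rank-one operators\<close>

lemma bounded_clinear_add: "bounded_clinear X \<Longrightarrow> X (x + y) = X x + X y"
  and bounded_clinear_scaleC: "bounded_clinear X \<Longrightarrow> X (c *\<^sub>C x) = c *\<^sub>C X x"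
  and bounded_clinear_diff: "bounded_clinear X \<Longrightarrow> X (x - y) = X x - X y"
  by (simp_all add: bounded_clinear_def linear_simps)

lemma positive_op_clinear: "positive_op P \<Longrightarrow> bounded_clinear P"
  by (simp add: positive_op_def)

lemma positive_op_nonneg: "positive_op P \<Longrightarrow> 0 \<le> Re (cinner x (P x))"
  by (auto simp: positive_op_def complex_nonneg_Reals_iff)

lemma positive_op_Im: "positive_op P \<Longrightarrow> Im (cinner x (P x)) = 0"
  by (auto simp: positive_op_def complex_nonneg_Reals_iff)

lemma cinner_cnj: "cnj (cinner x y) = cinner y x"
  by (rule cinner_commute[symmetric])

lemma positive_op_form:
  assumes "positive_op P"
  shows positive_op_hermitian: "cinner (P y) x = cinner y (P x)"
    and positive_op_cauchy_schwarz: "(cmod (cinner x (P y)))\<^sup>2 \<le> Re (cinner x (P x)) * Re (cinner y (P y))"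
proof -
  have form: "cnj s * s * cinner x (P x) + cnj s * t * cinner x (P y) + cnj t * s * cinner y (P x)
      + cnj t * t * cinner y (P y) \<in> \<real>\<^sub>\<ge>\<^sub>0" for s t
  proof -
    have "cinner (s *\<^sub>C x + t *\<^sub>C y) (P (s *\<^sub>C x + t *\<^sub>C y)) \<in> \<real>\<^sub>\<ge>\<^sub>0"
      using assms by (simp add: positive_op_def)
    then show ?thesis
      using positive_op_clinear[OF assms]
      by (simp add: bounded_clinear_add bounded_clinear_scaleC cinner_add_left cinner_add_right
          cinner_scaleC_left cinner_scaleC_right algebra_simps)
  qed
  show "(cmod (cinner x (P y)))\<^sup>2 \<le> Re (cinner x (P x)) * Re (cinner y (P y))"
    by (rule nonneg_form2_le[OF form])
  show "cinner (P y) x = cinner y (P x)"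
    using nonneg_form2_cnj[OF form] cinner_commute[of x "P y"] by simp
qed

lemma bounded_clinear_ident: "bounded_clinear (\<lambda>x. x)"
  by (simp add: bounded_clinear_def bounded_linear_ident)

lemma cmod_cinner_le: "cmod (cinner x y) \<le> norm x * norm y"
proof -
  have "positive_op (\<lambda>x. x :: 'a)"
    by (simp add: positive_op_def bounded_clinear_ident norm_cinner)
  from positive_op_cauchy_schwarz[OF this, of x y]
  have "(cmod (cinner x y))\<^sup>2 \<le> (norm x * norm y)\<^sup>2"
    by (simp add: norm_cinner power_mult_distrib)
  then show ?thesis
    by (rule power2_le_imp_le) simp
qed

lemma cinner_scaleR: "cinner (r *\<^sub>R x) y = r *\<^sub>R cinner x y" "cinner x (r *\<^sub>R y) = r *\<^sub>R cinner x y"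
  by (simp_all add: scaleC_of_real[of r x, symmetric] scaleC_of_real[of r y, symmetric] cinner_scaleC_left cinner_scaleC_right scaleR_conv_of_real)

interpretation cinner: bounded_bilinear "cinner :: 'h::chilbert_space \<Rightarrow> 'h \<Rightarrow> complex"
  by unfold_locales
    (auto simp: cinner_add_left cinner_add_right cinner_scaleR cmod_cinner_le intro: exI[of _ 1])

lemma cinner_right_eqI:
  assumes "\<And>x. cinner x y = cinner x z"
  shows "y = z"
proof -
  have "cinner (y - z) (y - z) = 0"
    using assms[of "y - z"] by (simp add: cinner.diff_right)
  then show ?thesis
    by (simp add: norm_cinner)
qed

lemma op_eqI: "(\<And>x y. cinner x (X y) = cinner x (Y y)) \<Longrightarrow> X = Y"
  by (rule ext, rule cinner_right_eqI)

text \<open>The operator |v><w| in Dirac notation; it is antilinear in \<open>w\<close>.\<close>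

definition outer :: "'h::chilbert_space \<Rightarrow> 'h \<Rightarrow> 'h \<Rightarrow> 'h" where
  "outer v w x = cinner w x *\<^sub>C v"

lemma bounded_clinear_outer: "bounded_clinear (outer v w)"
proof -
  have "bounded_linear (\<lambda>x. cinner w x *\<^sub>C v)"
  proof (rule bounded_linear_intro)
    show "norm (cinner w x *\<^sub>C v) \<le> norm x * (norm w * norm v)" for x
      using mult_right_mono[OF cmod_cinner_le[of w x] norm_ge_zero[of v]]
      by (simp add: norm_scaleC ac_simps)
  qed (simp_all add: cinner_add_right scaleC_add_left cinner_scaleR scaleR_conv_of_real
      scaleC_scaleC[symmetric] scaleC_of_real)
  then show ?thesis
    by (simp add: bounded_clinear_def outer_def[abs_def] cinner_scaleC_right scaleC_scaleC)
qed

lemma cinner_outer: "cinner x (outer v w y) = cinner x v * cinner w y"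
  by (simp add: outer_def cinner_scaleC_right)

lemma cinner_outer_self: "cinner x (outer v v x) = complex_of_real ((cmod (cinner v x))\<^sup>2)"
  unfolding cinner_outer complex_norm_square cinner_cnj by (rule mult.commute)

lemma bounded_clinear_plus:
  assumes "bounded_clinear X" "bounded_clinear Y"
  shows "bounded_clinear (\<lambda>x. X x + Y x)"
  using assms by (simp add: bounded_clinear_def bounded_linear_add scaleC_add_right)

lemma bounded_linear_scaleC: "bounded_linear (\<lambda>x. c *\<^sub>C x)"
proof (rule bounded_linear_intro)
  show "norm (c *\<^sub>C x) \<le> norm x * cmod c" for x
    by (simp add: norm_scaleC)
  show "c *\<^sub>C r *\<^sub>R x = r *\<^sub>R c *\<^sub>C x" for r x
    by (simp add: scaleC_of_real[symmetric] scaleC_scaleC mult.commute)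
qed (simp add: scaleC_add_right)

lemma bounded_clinear_cmult:
  assumes "bounded_clinear X"
  shows "bounded_clinear (\<lambda>x. c *\<^sub>C X x)"
  using assms by (simp add: bounded_clinear_def bounded_linear_compose[OF bounded_linear_scaleC]
      scaleC_scaleC mult.commute)

lemma bounded_clinear_compose:
  assumes "bounded_clinear X" "bounded_clinear Y"
  shows "bounded_clinear (X \<circ> Y)"
  using assms by (simp add: bounded_clinear_def bounded_linear_compose comp_def)


section \<open>Orthonormal families\<close>

definition orthonormal :: "'h::chilbert_space set \<Rightarrow> bool" where
  "orthonormal B \<longleftrightarrow> (\<forall>e\<in>B. norm e = 1) \<and> (\<forall>e\<in>B. \<forall>f\<in>B. e \<noteq> f \<longrightarrow> cinner e f = 0)"

lemma is_onb_orthonormal: "is_onb B \<Longrightarrow> orthonormal B"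
  by (simp add: is_onb_def orthonormal_def)

lemma orthonormal_subset: "orthonormal B \<Longrightarrow> F \<subseteq> B \<Longrightarrow> orthonormal F"
  by (auto simp: orthonormal_def)

lemma orthonormal_cinner: "orthonormal B \<Longrightarrow> e \<in> B \<Longrightarrow> f \<in> B \<Longrightarrow> cinner e f = (if e = f then 1 else 0)"
  by (auto simp: orthonormal_def norm_cinner)

lemma cinner_orthonormal_sum:
  assumes "orthonormal B" "finite F" "F \<subseteq> B" "f \<in> B"
  shows "cinner f (\<Sum>e\<in>F. c e *\<^sub>C e) = (if f \<in> F then c f else 0)"
proof -
  have "cinner f (\<Sum>e\<in>F. c e *\<^sub>C e) = (\<Sum>e\<in>F. if e = f then c e else 0)"
    unfolding cinner.sum_right
    by (rule sum.cong) (use assms in \<open>auto simp: cinner_scaleC_right orthonormal_cinner[OF assms(1)] subset_iff\<close>)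
  then show ?thesis
    using assms(2) by (simp add: sum.delta)
qed

lemma norm_orthonormal_sum:
  assumes "orthonormal F" "finite F"
  shows "(norm (\<Sum>e\<in>F. c e *\<^sub>C e))\<^sup>2 = (\<Sum>e\<in>F. (cmod (c e))\<^sup>2)"
proof -
  have "cinner (\<Sum>e\<in>F. c e *\<^sub>C e) (\<Sum>e\<in>F. c e *\<^sub>C e) = (\<Sum>e\<in>F. cnj (c e) * c e)"
    unfolding cinner.sum_left
    by (rule sum.cong) (use assms in \<open>auto simp: cinner_scaleC_left cinner_orthonormal_sum[OF assms(1)]\<close>)
  also have "\<dots> = complex_of_real (\<Sum>e\<in>F. (cmod (c e))\<^sup>2)"
    unfolding of_real_sum by (rule sum.cong) (simp_all only: complex_norm_square mult.commute)
  finally show ?thesis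
    by (simp only: norm_cinner of_real_eq_iff)
qed

lemma norm_diff_orthonormal_sum:
  assumes "orthonormal F" "finite F"
  shows "(norm (x - (\<Sum>e\<in>F. cinner e x *\<^sub>C e)))\<^sup>2 = (norm x)\<^sup>2 - (\<Sum>e\<in>F. (cmod (cinner e x))\<^sup>2)"
proof -
  define p where "p = (\<Sum>e\<in>F. cinner e x *\<^sub>C e)"
  have "cinner p x = (\<Sum>e\<in>F. cnj (cinner e x) * cinner e x)"
    unfolding p_def cinner.sum_left by (simp add: cinner_scaleC_left)
  also have "\<dots> = complex_of_real (\<Sum>e\<in>F. (cmod (cinner e x))\<^sup>2)"
    unfolding of_real_sum by (rule sum.cong) (simp_all only: complex_norm_square mult.commute)
  finally have px: "cinner p x = complex_of_real (\<Sum>e\<in>F. (cmod (cinner e x))\<^sup>2)" .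
  have pp: "cinner p p = complex_of_real (\<Sum>e\<in>F. (cmod (cinner e x))\<^sup>2)"
    unfolding norm_cinner p_def norm_orthonormal_sum[OF assms] ..
  have "cinner (x - p) (x - p) = cinner x x - cnj (cinner p x) - cinner p x + cinner p p"
    by (simp add: cinner.diff_left cinner.diff_right cinner_cnj)
  also have "\<dots> = complex_of_real ((norm x)\<^sup>2 - (\<Sum>e\<in>F. (cmod (cinner e x))\<^sup>2))"
    unfolding px pp by (simp add: norm_cinner)
  finally show ?thesis
    unfolding norm_cinner p_def of_real_eq_iff .
qed

lemma bessel:
  assumes "orthonormal F" "finite F"
  shows "(\<Sum>e\<in>F. (cmod (cinner e x))\<^sup>2) \<le> (norm x)\<^sup>2"
  using norm_diff_orthonormal_sum[OF assms, of x] zero_le_power2[of "norm (x - (\<Sum>e\<in>F. cinner e x *\<^sub>C e))"]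
  by linarith

text \<open>\<open>B\<close> may be uncountable, so the series is summed along an increasing
  sequence of finite sets whose square sums approach the supremum \<open>S\<close>. What later sets
  add is then small, which makes the partial sums Cauchy. The second conclusion later provides
  expansions in a basis.\<close>

lemma riesz_fischer:
  assumes B: "orthonormal B"
    and K: "\<And>F. finite F \<Longrightarrow> F \<subseteq> B \<Longrightarrow> (\<Sum>e\<in>F. (cmod (c e))\<^sup>2) \<le> K"
  obtains y where "\<And>e. e \<in> B \<Longrightarrow> cinner e y = c e"
    "\<And>d. d > 0 \<Longrightarrow> \<exists>F. finite F \<and> F \<subseteq> B \<and> norm (y - (\<Sum>e\<in>F. c e *\<^sub>C e)) < d"
proof -
  define q where "q F = (\<Sum>e\<in>F. (cmod (c e))\<^sup>2)" for F
  define S where "S = (SUP F\<in>{F. finite F \<and> F \<subseteq> B}. q F)"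
  have bdd: "bdd_above (q ` {F. finite F \<and> F \<subseteq> B})"
    using K by (auto intro!: bdd_aboveI[of _ K] simp: q_def)
  have qS: "q F \<le> S" if "finite F" "F \<subseteq> B" for F
    unfolding S_def using that by (intro cSUP_upper bdd) auto
  have "\<exists>F. (finite F \<and> F \<subseteq> B) \<and> S - inverse (Suc n) < q F" for n
    using less_cSUP_iff[of "{F. finite F \<and> F \<subseteq> B}" q "S - inverse (Suc n)"] bdd
    unfolding S_def[symmetric] by auto
  then obtain F0 where F0: "\<And>n. finite (F0 n)" "\<And>n. F0 n \<subseteq> B" "\<And>n. S - inverse (Suc n) < q (F0 n)"
    by metis
  define F where "F n = (\<Union>k\<le>n. F0 k)" for n
  have F: "finite (F n)" "F n \<subseteq> B" for n
    unfolding F_def using F0 by auto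
  have mono: "F m \<subseteq> F n" if "m \<le> n" for m n
    unfolding F_def using that by (meson UN_mono atMost_subset_iff subset_refl)
  have q_mono: "q A \<le> q A'" if "finite A'" "A \<subseteq> A'" for A A'
    unfolding q_def using that by (intro sum_mono2) auto
  have qF: "S - inverse (Suc n) < q (F n)" for n
    using F0(3)[of n] q_mono[OF F(1)[of n], of "F0 n"] by (force simp: F_def)
  define s where "s n = (\<Sum>e\<in>F n. c e *\<^sub>C e)" for n
  have s_diff: "(norm (s n - s m))\<^sup>2 \<le> inverse (Suc m)" if "m \<le> n" for m n
  proof -
    have "s n - s m = (\<Sum>e\<in>F n - F m. c e *\<^sub>C e)"
      unfolding s_def using mono[OF that] F(1) by (simp add: sum_diff)
    then have "(norm (s n - s m))\<^sup>2 = q (F n - F m)"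
      using norm_orthonormal_sum[of "F n - F m" c] orthonormal_subset[OF B] F[of n]
      by (simp add: q_def subset_iff)
    also have "\<dots> = q (F n) - q (F m)"
      unfolding q_def using mono[OF that] F(1) by (simp add: sum_diff)
    also have "\<dots> \<le> inverse (Suc m)"
      using qF[of m] qS[OF F, of n] by simp
    finally show ?thesis .
  qed
  have small: "\<exists>m. inverse (real (Suc m)) < d" if "d > 0" for d
    using reals_Archimedean that by blast
  have "Cauchy s"
    unfolding Cauchy_altdef
  proof (intro allI impI)
    fix d :: real assume "d > 0"
    then obtain m where m: "inverse (real (Suc m)) < (d / 2)\<^sup>2"
      using small[of "(d / 2)\<^sup>2"] by auto
    have near: "norm (s n - s m) < d / 2" if "n \<ge> m" for n
      using s_diff[OF that] m \<open>d > 0\<close> by (intro power2_less_imp_less[of _ "d / 2"]) auto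
    show "\<exists>M. \<forall>m\<ge>M. \<forall>n>m. dist (s m) (s n) < d"
    proof (intro exI[of _ m] allI impI)
      fix i j assume "m \<le> i" "i < j"
      then show "dist (s i) (s j) < d"
        using dist_triangle_half_r[of "s m" "s i" d "s j"] near[of i] near[of j]
        by (simp add: dist_norm norm_minus_commute)
    qed
  qed
  then obtain y where y: "s \<longlonglongrightarrow> y"
    using Cauchy_convergent convergent_def by blast
  show ?thesis
  proof
    fix e assume e: "e \<in> B"
    have lim: "(\<lambda>n. cinner e (s n)) \<longlonglongrightarrow> cinner e y"
      using y by (intro cinner.tendsto tendsto_const)
    have val: "cinner e (s n) = (if e \<in> F n then c e else 0)" for n
      unfolding s_def by (rule cinner_orthonormal_sum[OF B F e])
    show "cinner e y = c e"
    proof (cases "\<exists>n. e \<in> F n")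
      case True
      then obtain n where "e \<in> F n" by blast
      then have "eventually (\<lambda>n. cinner e (s n) = c e) sequentially"
        unfolding eventually_sequentially using mono val by (auto intro!: exI[of _ n])
      then have "(\<lambda>n. cinner e (s n)) \<longlonglongrightarrow> c e"
        by (rule tendsto_eventually)
      then show ?thesis using lim LIMSEQ_unique by blast
    next
      case False
      \<comment> \<open>An index outside every \<open>F n\<close> carries no weight: adjoining it to
        \<open>F n\<close> must not push the square sum above \<open>S\<close>.\<close>
      have "(cmod (c e))\<^sup>2 \<le> inverse (Suc n)" for n
      proof -
        have "q (insert e (F n)) = (cmod (c e))\<^sup>2 + q (F n)"
          unfolding q_def using F False by simp
        moreover have "q (insert e (F n)) \<le> S"
          using F e by (intro qS) auto
        ultimately show ?thesis using qF[of n] by simp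
      qed
      then have "\<not> (cmod (c e))\<^sup>2 > 0"
        using small not_less by metis
      then have "c e = 0" by simp
      moreover have "cinner e y = 0"
        using lim False val LIMSEQ_unique[of "\<lambda>n. 0" 0 "cinner e y"] by simp
      ultimately show ?thesis by simp
    qed
  next
    fix d :: real assume "d > 0"
    then obtain n where "dist (s n) y < d"
      using y unfolding lim_sequentially by blast
    then show "\<exists>F. finite F \<and> F \<subseteq> B \<and> norm (y - (\<Sum>e\<in>F. c e *\<^sub>C e)) < d"
      using F unfolding s_def by (auto simp: dist_norm norm_minus_commute)
  qed
qed

text \<open>The vector that \<open>riesz_fischer\<close> builds from the coefficients of
  \<open>x\<close> differs from \<open>x\<close> by a vector orthogonal to \<open>B\<close>, which
  is 0.\<close>

lemma is_onb_expansion: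
  assumes B: "is_onb B" and "d > 0"
  obtains F where "finite F" "F \<subseteq> B" "norm (x - (\<Sum>e\<in>F. cinner e x *\<^sub>C e)) < d"
proof -
  note on = is_onb_orthonormal[OF B]
  obtain y where y: "\<And>e. e \<in> B \<Longrightarrow> cinner e y = cinner e x"
    "\<And>d. d > 0 \<Longrightarrow> \<exists>F. finite F \<and> F \<subseteq> B \<and> norm (y - (\<Sum>e\<in>F. cinner e x *\<^sub>C e)) < d"
    by (rule riesz_fischer[OF on, of "\<lambda>e. cinner e x" "(norm x)\<^sup>2"])
      (auto intro: bessel orthonormal_subset[OF on])
  have "\<forall>e\<in>B. cinner e (y - x) = 0"
    using y(1) by (simp add: cinner.diff_right)
  then have "y = x"
    using B by (auto simp: is_onb_def)
  then show ?thesis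
    using y(2)[OF assms(2)] that by blast
qed

lemma parseval_approx:
  assumes B: "is_onb B" and "d > 0"
  obtains F where "finite F" "F \<subseteq> B" "(norm x)\<^sup>2 \<le> (\<Sum>e\<in>F. (cmod (cinner e x))\<^sup>2) + d"
proof -
  obtain F where F: "finite F" "F \<subseteq> B" "norm (x - (\<Sum>e\<in>F. cinner e x *\<^sub>C e)) < sqrt d"
    using is_onb_expansion[OF B, of "sqrt d" x] assms(2) by auto
  have "(norm (x - (\<Sum>e\<in>F. cinner e x *\<^sub>C e)))\<^sup>2 < (sqrt d)\<^sup>2"
    using F(3) by (intro power_strict_mono) auto
  then show ?thesis
    using norm_diff_orthonormal_sum[OF orthonormal_subset[OF is_onb_orthonormal[OF B] F(2)] F(1), of x]
      assms(2) F by (intro that[of F]) auto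
qed

text \<open>A unit vector orthogonal to a maximal orthonormal set could be adjoined to it; Zorn's
  lemma supplies such a set and hence a witness for the choice in \<open>onb\<close>.\<close>

lemma is_onb_onb: "is_onb onb"
proof -
  have "\<exists>M\<in>Collect orthonormal. \<forall>X\<in>Collect orthonormal. M \<subseteq> X \<longrightarrow> X = (M :: 'a set)"
  proof (rule subset_Zorn')
    fix C :: "'a set set" assume C: "subset.chain (Collect orthonormal) C"
    then have on: "orthonormal X" if "X \<in> C" for X
      using that by (auto simp: subset_chain_def)
    have "\<exists>X\<in>C. e \<in> X \<and> f \<in> X" if "e \<in> \<Union>C" "f \<in> \<Union>C" for e f
      using C that unfolding subset_chain_def by blast
    then show "\<Union>C \<in> Collect orthonormal"
      using on unfolding orthonormal_def by blast
  qed
  then obtain M :: "'a set" where M: "orthonormal M" "\<And>X. orthonormal X \<Longrightarrow> M \<subseteq> X \<Longrightarrow> X = M"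
    by auto
  have "x = 0" if x: "\<forall>e\<in>M. cinner e x = 0" for x
  proof (rule ccontr)
    assume "x \<noteq> 0"
    define u where "u = inverse (norm x) *\<^sub>R x"
    have u: "norm u = 1" "\<forall>e\<in>M. cinner e u = 0" "\<forall>e\<in>M. cinner u e = 0"
      using \<open>x \<noteq> 0\<close> x cinner_commute[of x] by (auto simp: u_def cinner_scaleR)
    then have "orthonormal (insert u M)"
      using M(1) by (auto simp: orthonormal_def)
    then have "u \<in> M"
      using M(2)[of "insert u M"] by blast
    then show False
      using u norm_cinner[of u] by auto
  qed
  then have "is_onb M"
    using M(1) by (auto simp: is_onb_def orthonormal_def)
  then show ?thesis
    unfolding onb_def by (rule someI)
qed

text \<open>A representing vector must have the coefficients \<open>cnj (\<phi> e)\<close>. Once it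
  is built, the difference \<psi> is bounded and vanishes on finite combinations of basis vectors,
  which are dense.\<close>

lemma riesz_representation:
  fixes \<phi> :: "'h::chilbert_space \<Rightarrow> complex"
  assumes add: "\<And>x y. \<phi> (x + y) = \<phi> x + \<phi> y"
    and scale: "\<And>c x. \<phi> (c *\<^sub>C x) = c * \<phi> x"
    and bound: "\<And>x. cmod (\<phi> x) \<le> K * norm x"
  obtains z where "\<And>x. \<phi> x = cinner z x"
proof -
  note on = is_onb_orthonormal[OF is_onb_onb]
  have zero: "\<phi> 0 = 0" using add[of 0 0] by simp
  have sum: "\<phi> (\<Sum>e\<in>F. f e) = (\<Sum>e\<in>F. \<phi> (f e))" for F :: "'h set" and f
    by (induction F rule: infinite_finite_induct) (simp_all add: zero add)
  have "(\<Sum>e\<in>F. (cmod (cnj (\<phi> e)))\<^sup>2) \<le> K\<^sup>2" if F: "finite F" "F \<subseteq> onb" for F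
  proof -
    \<comment> \<open>A test vector with \<open>\<phi> p = (norm p)\<^sup>2\<close>; the bound on
      \<phi> at \<open>p\<close> gives \<open>norm p \<le> K\<close> unless \<open>p\<close> is
      0.\<close>
    define p where "p = (\<Sum>e\<in>F. cnj (\<phi> e) *\<^sub>C e)"
    define q where "q = (\<Sum>e\<in>F. (cmod (cnj (\<phi> e)))\<^sup>2)"
    have np: "(norm p)\<^sup>2 = q"
      unfolding p_def q_def using norm_orthonormal_sum[OF orthonormal_subset[OF on F(2)] F(1)] .
    have "\<phi> p = (\<Sum>e\<in>F. cnj (\<phi> e) * \<phi> e)"
      unfolding p_def sum by (simp add: scale)
    also have "\<dots> = complex_of_real q"
      unfolding q_def of_real_sum by (rule sum.cong) (simp_all only: complex_norm_square complex_cnj_cnj)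
    finally have "q \<le> K * norm p"
      using bound[of p] by simp
    then have "norm p * norm p \<le> K * norm p"
      using np by (simp add: power2_eq_square)
    then have "norm p \<le> K \<or> norm p = 0"
      by (auto simp: mult_le_cancel_right)
    then have "(norm p)\<^sup>2 \<le> K\<^sup>2"
      by (auto intro: power_mono)
    then show ?thesis using np by (simp add: q_def)
  qed
  then obtain z where z: "\<And>e. e \<in> onb \<Longrightarrow> cinner e z = cnj (\<phi> e)"
    by (rule riesz_fischer[OF on, of "\<lambda>e. cnj (\<phi> e)" "K\<^sup>2"]) blast+
  define \<psi> where "\<psi> x = \<phi> x - cinner z x" for x
  have \<psi>_diff: "\<psi> (x - y) = \<psi> x - \<psi> y" for x y
    using add[of "x - y" y] by (simp add: \<psi>_def cinner.diff_right)
  have bound': "cmod (\<psi> x) \<le> (K + norm z) * norm x" for x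
    unfolding \<psi>_def using bound[of x] cmod_cinner_le[of z x] norm_triangle_ineq4[of "\<phi> x" "cinner z x"]
    by (simp add: distrib_right)
  have "\<phi> e = cinner z e" if "e \<in> onb" for e
    using z[OF that] cinner_commute[of z e] by simp
  then have \<psi>_onb: "\<psi> (\<Sum>e\<in>F. c e *\<^sub>C e) = 0" if "F \<subseteq> onb" for F c
    unfolding \<psi>_def sum cinner.sum_right using that by (auto simp: scale cinner_scaleC_right intro!: sum.cong)
  have "\<psi> x = 0" for x
  proof (rule ccontr)
    assume "\<psi> x \<noteq> 0"
    then have pos: "cmod (\<psi> x) > 0" by simp
    define L where "L = \<bar>K\<bar> + norm z + 1"
    have L: "L > 0" by (simp add: L_def add_nonneg_pos)
    obtain F where F: "finite F" "F \<subseteq> onb" "norm (x - (\<Sum>e\<in>F. cinner e x *\<^sub>C e)) < cmod (\<psi> x) / L"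
      using is_onb_expansion[OF is_onb_onb, of "cmod (\<psi> x) / L" x] pos L by auto
    have "cmod (\<psi> x) = cmod (\<psi> (x - (\<Sum>e\<in>F. cinner e x *\<^sub>C e)))"
      using \<psi>_onb[OF F(2)] by (simp add: \<psi>_diff)
    also have "\<dots> \<le> L * norm (x - (\<Sum>e\<in>F. cinner e x *\<^sub>C e))"
      by (rule order_trans[OF bound'], rule mult_right_mono) (auto simp: L_def)
    also have "\<dots> < cmod (\<psi> x)"
      using F(3) L by (simp add: field_simps)
    finally show False by simp
  qed
  then show ?thesis
    by (intro that[of z]) (simp add: \<psi>_def)
qed

text \<open>For fixed \<open>y\<close> the conjugate of \<open>q x y\<close> is a bounded linear
  functional of \<open>x\<close>, and \<open>X y\<close> represents it. The bound on
  \<open>X\<close> comes from testing with \<open>x = X y\<close>.\<close>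

lemma form_operator:
  fixes q :: "'h::chilbert_space \<Rightarrow> 'h \<Rightarrow> complex"
  assumes add_left: "\<And>x x' y. q (x + x') y = q x y + q x' y"
    and scale_left: "\<And>c x y. q (c *\<^sub>C x) y = cnj c * q x y"
    and add_right: "\<And>x y y'. q x (y + y') = q x y + q x y'"
    and scale_right: "\<And>c x y. q x (c *\<^sub>C y) = c * q x y"
    and bound: "\<And>x y. cmod (q x y) \<le> K * norm x * norm y"
  obtains X where "bounded_clinear X" "\<And>x y. cinner x (X y) = q x y"
proof -
  have "\<exists>z. \<forall>x. cinner x z = q x y" for y
  proof -
    obtain z where "\<And>x. cnj (q x y) = cinner z x"
    proof (rule riesz_representation[of "\<lambda>x. cnj (q x y)" "K * norm y"])
      show "cmod (cnj (q x y)) \<le> K * norm y * norm x" for x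
        using bound[of x y] by (simp add: ac_simps)
    qed (auto simp: add_left scale_left)
    then show ?thesis
      by (metis cinner_commute complex_cnj_cnj)
  qed
  then obtain X where X: "\<And>x y. cinner x (X y) = q x y" by metis
  have addX: "X (y + y') = X y + X y'" for y y'
    by (rule cinner_right_eqI) (simp add: X add_right cinner_add_right)
  have scaleX: "X (c *\<^sub>C y) = c *\<^sub>C X y" for c y
    by (rule cinner_right_eqI) (simp add: X scale_right cinner_scaleC_right)
  have "norm (X y) \<le> norm y * \<bar>K\<bar>" for y
  proof -
    have "norm (X y) * norm (X y) = cmod (q (X y) y)"
      using norm_cinner[of "X y"] by (simp add: X power2_eq_square norm_mult)
    also have "\<dots> \<le> K * norm (X y) * norm y"
      by (rule bound)
    also have "\<dots> \<le> (norm y * \<bar>K\<bar>) * norm (X y)"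
      by (simp add: ac_simps mult_mono)
    finally show ?thesis
      by (cases "norm (X y) = 0") (auto simp: mult_le_cancel_right)
  qed
  then have "bounded_linear X"
    by (intro bounded_linear_intro[of X "\<bar>K\<bar>"]) (simp_all add: addX scaleX scaleC_of_real[symmetric])
  then show ?thesis
    using X scaleX by (intro that[of X]) (simp_all add: bounded_clinear_def)
qed


section \<open>Positive operators and the trace class\<close>

lemma positive_op_kernel:
  assumes "positive_op R" "Re (cinner e (R e)) = 0"
  shows "R e = 0"
proof (rule cinner_right_eqI)
  fix x
  show "cinner x (R e) = cinner x 0"
    using positive_op_cauchy_schwarz[OF assms(1), of x e] assms(2) by (simp add: cinner.zero_right)
qed

text \<open>Symmetric Gaussian elimination: subtracting the rank-one operator built from \<open>R e\<close> keeps
  \<open>R\<close> positive, by the Cauchy--Schwarz inequality for the form of \<open>R\<close>, and puts \<open>e\<close> in its kernel.\<close>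

lemma cholesky:
  assumes "positive_op P" "finite F"
  shows "\<exists>n v R. positive_op R \<and> (\<forall>x. P x = (\<Sum>i<(n::nat). outer (v i) (v i) x) + R x) \<and> (\<forall>e\<in>F. R e = 0)"
  using assms(2)
proof (induction F rule: finite_induct)
  case empty
  show ?case
    using assms(1) by (intro exI[of _ "0::nat"] exI[of _ "\<lambda>_. 0"] exI[of _ P]) simp
next
  case (insert e F)
  then obtain n :: nat and v R where R: "positive_op R"
    and P: "\<And>x. P x = (\<Sum>i<n. outer (v i) (v i) x) + R x" and F: "\<And>f. f \<in> F \<Longrightarrow> R f = 0"
    by blast
  define r where "r = Re (cinner e (R e))"
  show ?case
  proof (cases "r = 0")
    case True
    then have "R e = 0"
      using positive_op_kernel[OF R] by (simp add: r_def)
    then show ?thesis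
      using R P F by blast
  next
    case False
    then have r: "r > 0"
      using positive_op_nonneg[OF R, of e] by (simp add: r_def)
    have eRe: "cinner e (R e) = complex_of_real r"
      using positive_op_Im[OF R, of e] by (simp add: r_def complex_eq_iff)
    \<comment> \<open>The normalisation gives \<open>outer w w e = R e\<close>, because
      \<open>cinner e (R e) = r\<close>.\<close>
    define w where "w = complex_of_real (1 / sqrt r) *\<^sub>C R e"
    have w: "cinner w x = complex_of_real (1 / sqrt r) * cinner e (R x)" for x
      using positive_op_hermitian[OF R, of e x] by (simp add: w_def cinner_scaleC_left)
    have w2: "(cmod (cinner w x))\<^sup>2 = (cmod (cinner e (R x)))\<^sup>2 / r" for x
      using r by (simp add: w norm_divide power_divide norm_mult)
    define R' where "R' x = R x + (- 1) *\<^sub>C outer w w x" for x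
    have R'_alt: "R' x = R x - outer w w x" for x
      by (simp add: R'_def scaleC_minus_left scaleC_one)
    have "positive_op R'"
      unfolding positive_op_def
    proof (intro conjI allI)
      show "bounded_clinear R'"
        unfolding R'_def[abs_def]
        by (intro bounded_clinear_plus bounded_clinear_cmult bounded_clinear_outer positive_op_clinear R)
      fix x
      have "(cmod (cinner w x))\<^sup>2 \<le> Re (cinner x (R x))"
        using positive_op_cauchy_schwarz[OF R, of e x] r
        by (simp add: w2 r_def[symmetric] field_simps)
      then show "cinner x (R' x) \<in> \<real>\<^sub>\<ge>\<^sub>0"
        using positive_op_Im[OF R, of x]
        by (simp add: R'_alt cinner.diff_right cinner_outer_self complex_nonneg_Reals_iff)
    qed
    moreover have "P x = (\<Sum>i<Suc n. outer ((v(n := w)) i) ((v(n := w)) i) x) + R' x" for x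
    proof -
      have "(\<Sum>i<n. outer ((v(n := w)) i) ((v(n := w)) i) x) = (\<Sum>i<n. outer (v i) (v i) x)"
        by (rule sum.cong) auto
      then show ?thesis
        by (simp add: P R'_alt)
    qed
    moreover have "R' f = 0" if "f \<in> insert e F" for f
    proof (cases "f = e")
      case True
      have "outer w w e = (complex_of_real (1 / sqrt r) * r * complex_of_real (1 / sqrt r)) *\<^sub>C R e"
        unfolding outer_def w eRe by (simp add: w_def scaleC_scaleC)
      also have "complex_of_real (1 / sqrt r) * r * complex_of_real (1 / sqrt r) = 1"
        using r unfolding of_real_mult[symmetric] by (simp add: field_simps)
      finally show ?thesis
        by (simp add: True R'_alt scaleC_one)
    next
      case False
      \<comment> \<open>Vectors eliminated earlier stay in the kernel: \<open>cinner w f\<close> is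
        a multiple of \<open>cinner e (R f)\<close>.\<close>
      then have "R f = 0" using that F by simp
      then show ?thesis
        by (simp add: R'_alt outer_def w cinner.zero_right scaleC_zero_left)
    qed
    ultimately show ?thesis by blast
  qed
qed

lemma parseval_approx_sum:
  fixes n :: nat
  assumes "d > 0"
  shows "\<exists>F. finite F \<and> F \<subseteq> onb \<and>
    (\<Sum>i<n. (norm (v i))\<^sup>2) \<le> (\<Sum>e\<in>F. \<Sum>i<n. (cmod (cinner (v i) e))\<^sup>2) + d" (is "\<exists>F. ?P F n d")
  using assms
proof (induction n arbitrary: d)
  case 0
  then show ?case by (intro exI[of _ "{}"]) simp
next
  case (Suc n)
  obtain F where F: "?P F n (d / 2)" using Suc.IH[of "d / 2"] Suc.prems by auto
  obtain F' where F': "finite F'" "F' \<subseteq> onb" "(norm (v n))\<^sup>2 \<le> (\<Sum>e\<in>F'. (cmod (cinner e (v n)))\<^sup>2) + d / 2"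
    using parseval_approx[OF is_onb_onb, of "d / 2" "v n"] Suc.prems by auto
  have swap: "cmod (cinner e (v n)) = cmod (cinner (v n) e)" for e
    by (metis cinner_commute complex_mod_cnj)
  have "(\<Sum>e\<in>F. \<Sum>i<n. (cmod (cinner (v i) e))\<^sup>2) \<le> (\<Sum>e\<in>F \<union> F'. \<Sum>i<n. (cmod (cinner (v i) e))\<^sup>2)"
    using F F' by (intro sum_mono2) (auto intro: sum_nonneg)
  moreover have "(\<Sum>e\<in>F'. (cmod (cinner e (v n)))\<^sup>2) \<le> (\<Sum>e\<in>F \<union> F'. (cmod (cinner (v n) e))\<^sup>2)"
    unfolding swap using F F' by (intro sum_mono2) auto
  ultimately have "?P (F \<union> F') (Suc n) d"
    using F F' by (simp add: sum.distrib)
  then show ?case by blast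
qed

text \<open>Basis independence of the trace, in the form of an inequality against an arbitrary finite
  orthonormal set: there the operator may be replaced by its Cholesky part, whose trace is
  computed by Parseval.\<close>

lemma orthonormal_trace_le:
  assumes P: "positive_op P"
    and K: "\<And>F. finite F \<Longrightarrow> F \<subseteq> onb \<Longrightarrow> (\<Sum>e\<in>F. Re (cinner e (P e))) \<le> K"
    and F: "orthonormal F" "finite F"
  shows "(\<Sum>b\<in>F. Re (cinner b (P b))) \<le> K"
proof (rule field_le_epsilon)
  fix d :: real assume "d > 0"
  obtain n :: nat and v R where R: "positive_op R" and PR: "\<And>x. P x = (\<Sum>i<n. outer (v i) (v i) x) + R x"
    and RF: "\<And>b. b \<in> F \<Longrightarrow> R b = 0"
    using cholesky[OF P F(2)] by blast
  have RePx: "Re (cinner x (P x)) = (\<Sum>i<n. (cmod (cinner (v i) x))\<^sup>2) + Re (cinner x (R x))" for x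
    by (simp add: PR cinner_add_right cinner.sum_right cinner_outer_self)
  obtain F' where F': "finite F'" "F' \<subseteq> onb"
    "(\<Sum>i<n. (norm (v i))\<^sup>2) \<le> (\<Sum>e\<in>F'. \<Sum>i<n. (cmod (cinner (v i) e))\<^sup>2) + d"
    using parseval_approx_sum[OF \<open>d > 0\<close>, of v n] by blast
  have swap: "cmod (cinner (v i) b) = cmod (cinner b (v i))" for i b
    by (metis cinner_commute complex_mod_cnj)
  have "(\<Sum>b\<in>F. Re (cinner b (P b))) = (\<Sum>b\<in>F. \<Sum>i<n. (cmod (cinner b (v i)))\<^sup>2)"
    using RF by (simp add: RePx cinner.zero_right swap)
  also have "\<dots> = (\<Sum>i<n. \<Sum>b\<in>F. (cmod (cinner b (v i)))\<^sup>2)"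
    by (rule sum.swap)
  also have "\<dots> \<le> (\<Sum>i<n. (norm (v i))\<^sup>2)"
    by (intro sum_mono bessel F)
  also have "\<dots> \<le> (\<Sum>e\<in>F'. \<Sum>i<n. (cmod (cinner (v i) e))\<^sup>2) + d"
    by (rule F')
  \<comment> \<open>The remainder \<open>R\<close> vanishes on \<open>F\<close> but is only known to
    be nonnegative on the basis, which suffices in this direction.\<close>
  also have "(\<Sum>e\<in>F'. \<Sum>i<n. (cmod (cinner (v i) e))\<^sup>2) \<le> (\<Sum>e\<in>F'. Re (cinner e (P e)))"
    unfolding RePx using positive_op_nonneg[OF R] by (intro sum_mono) simp
  also have "\<dots> \<le> K"
    by (rule K[OF F'(1,2)])
  finally show "(\<Sum>b\<in>F. Re (cinner b (P b))) \<le> K + d" by simp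
qed

section \<open>The trace of positive operators through finite partial sums\<close>

lemma positive_finite_traceD:
  assumes "positive_finite_trace P"
  shows positive_finite_trace_positive: "positive_op P"
    and positive_finite_trace_has_sum: "((\<lambda>e. Re (cinner e (P e))) has_sum Re (op_trace P)) onb"
    and positive_finite_trace_Im: "Im (op_trace P) = 0"
proof -
  show P: "positive_op P"
    using assms by (simp add: positive_finite_trace_def)
  have s: "((\<lambda>e. cinner e (P e)) has_sum op_trace P) onb"
    using assms unfolding positive_finite_trace_def op_trace_def by (intro has_sum_infsum) simp
  show "((\<lambda>e. Re (cinner e (P e))) has_sum Re (op_trace P)) onb"
    using has_sum_Re[OF s] .
  have "((\<lambda>e. 0 :: real) has_sum Im (op_trace P)) (onb :: 'a set)"
    using has_sum_Im[OF s] by (simp add: positive_op_Im[OF P])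
  then show "Im (op_trace P) = 0"
    using has_sum_0_simp has_sum_unique by blast
qed

lemma orthonormal_sum_le_trace:
  assumes P: "positive_finite_trace P" and "orthonormal F" "finite F"
  shows "(\<Sum>b\<in>F. Re (cinner b (P b))) \<le> Re (op_trace P)"
proof (rule orthonormal_trace_le[OF positive_finite_trace_positive[OF P] _ assms(2,3)])
  fix F :: "'a set" assume "finite F" "F \<subseteq> onb"
  then show "(\<Sum>e\<in>F. Re (cinner e (P e))) \<le> Re (op_trace P)"
    using positive_op_nonneg[OF positive_finite_trace_positive[OF P]]
    by (intro finite_sum_le_has_sum[OF positive_finite_trace_has_sum[OF P]]) auto
qed

lemma onb_sum_le_trace:
  assumes "positive_finite_trace P" "F \<subseteq> onb" "finite F"
  shows "(\<Sum>b\<in>F. Re (cinner b (P b))) \<le> Re (op_trace P)"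
  using orthonormal_sum_le_trace[OF assms(1) _ assms(3)]
    orthonormal_subset[OF is_onb_orthonormal[OF is_onb_onb] assms(2)] by blast

lemma trace_approx:
  assumes P: "positive_finite_trace P" and "d > 0"
  obtains F where "finite F" "F \<subseteq> onb" "Re (op_trace P) \<le> (\<Sum>b\<in>F. Re (cinner b (P b))) + d"
proof -
  obtain F where "finite F" "F \<subseteq> onb" "dist (\<Sum>b\<in>F. Re (cinner b (P b))) (Re (op_trace P)) \<le> d"
    using has_sum_finite_approximation[OF positive_finite_trace_has_sum[OF P] assms(2)] by blast
  then show ?thesis
    by (intro that[of F]) (auto simp: dist_real_def)
qed

lemma positive_finite_traceI:
  assumes P: "positive_op P"
    and K: "\<And>F. finite F \<Longrightarrow> F \<subseteq> onb \<Longrightarrow> (\<Sum>e\<in>F. Re (cinner e (P e))) \<le> K"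
  shows "positive_finite_trace P" "Re (op_trace P) \<le> K"
proof -
  have "(\<lambda>e. Re (cinner e (P e))) summable_on onb"
    using positive_op_nonneg[OF P] K
    by (intro nonneg_bdd_above_summable_on) (auto intro!: bdd_aboveI[of _ K])
  then have "(\<lambda>e. complex_of_real (Re (cinner e (P e)))) summable_on onb"
    by (rule summable_on_of_real)
  moreover have "complex_of_real (Re (cinner e (P e))) = cinner e (P e)" for e
    using positive_op_Im[OF P] by (simp add: complex_eq_iff)
  ultimately show *: "positive_finite_trace P"
    using P by (simp add: positive_finite_trace_def)
  show "Re (op_trace P) \<le> K"
    using K by (intro has_sum_le_finite_sums[OF positive_finite_trace_has_sum[OF *]])
qed

lemma trace_nonneg:
  assumes "positive_finite_trace P"
  shows "0 \<le> Re (op_trace P)"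
  using onb_sum_le_trace[OF assms, of "{}"] by simp

lemma positive_op_plus:
  assumes "positive_op P" "positive_op Q"
  shows "positive_op (\<lambda>x. P x + Q x)"
  using assms unfolding positive_op_def
  by (auto simp: bounded_clinear_plus cinner_add_right intro: nonneg_Reals_add_I)

lemma positive_op_scale:
  assumes "positive_op P" "r \<ge> 0"
  shows "positive_op (\<lambda>x. complex_of_real r *\<^sub>C P x)"
  using assms unfolding positive_op_def
  by (auto simp: bounded_clinear_cmult cinner_scaleC_right intro!: nonneg_Reals_mult_I)

lemma positive_op_outer: "positive_op (outer v v)"
  by (simp add: positive_op_def bounded_clinear_outer cinner_outer_self del: of_real_power)

lemma positive_finite_trace_plus:
  assumes P: "positive_finite_trace P" and Q: "positive_finite_trace Q"
  shows "positive_finite_trace (\<lambda>x. P x + Q x)"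
proof (rule positive_finite_traceI)
  show "positive_op (\<lambda>x. P x + Q x)"
    by (intro positive_op_plus positive_finite_trace_positive P Q)
  show "(\<Sum>e\<in>F. Re (cinner e (P e + Q e))) \<le> Re (op_trace P) + Re (op_trace Q)"
    if "finite F" "F \<subseteq> onb" for F
    using onb_sum_le_trace[OF P that(2,1)] onb_sum_le_trace[OF Q that(2,1)]
    by (simp add: cinner_add_right sum.distrib)
qed

lemma positive_finite_trace_scale:
  assumes P: "positive_finite_trace P" and r: "r \<ge> 0"
  shows "positive_finite_trace (\<lambda>x. complex_of_real r *\<^sub>C P x)"
proof (rule positive_finite_traceI)
  show "positive_op (\<lambda>x. complex_of_real r *\<^sub>C P x)"
    by (intro positive_op_scale positive_finite_trace_positive P r)
  show "(\<Sum>e\<in>F. Re (cinner e (complex_of_real r *\<^sub>C P e))) \<le> r * Re (op_trace P)"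
    if "finite F" "F \<subseteq> onb" for F
    using mult_left_mono[OF onb_sum_le_trace[OF P that(2,1)] r]
    by (simp add: cinner_scaleC_right sum_distrib_left)
qed

lemma positive_finite_trace_outer:
  shows "positive_finite_trace (outer v v)" and trace_outer_le: "Re (op_trace (outer v v)) \<le> (norm v)\<^sup>2"
proof -
  have *: "(\<Sum>e\<in>F. Re (cinner e (outer v v e))) \<le> (norm v)\<^sup>2" if "finite F" "F \<subseteq> onb" for F
  proof -
    have "cmod (cinner v e) = cmod (cinner e v)" for e
      by (metis cinner_commute complex_mod_cnj)
    then show ?thesis
      using bessel[OF orthonormal_subset[OF is_onb_orthonormal[OF is_onb_onb] that(2)] that(1), of v]
      by (simp add: cinner_outer_self)
  qed
  show "positive_finite_trace (outer v v)" "Re (op_trace (outer v v)) \<le> (norm v)\<^sup>2"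
    using positive_finite_traceI[OF positive_op_outer *] by auto
qed

lemma positive_finite_trace_zero: "positive_finite_trace (\<lambda>x. 0)"
  using positive_finite_trace_outer[of 0] by (simp add: outer_def[abs_def] scaleC_zero_right)

text \<open>A unit vector by itself is a finite orthonormal set, so its diagonal element is at most
  the trace; Cauchy--Schwarz for the form of \<open>P\<close> passes to the other matrix
  elements.\<close>

lemma positive_finite_trace_bound:
  assumes P: "positive_finite_trace P"
  shows "cmod (cinner x (P y)) \<le> Re (op_trace P) * norm x * norm y"
proof -
  define t where "t = Re (op_trace P)"
  have t: "t \<ge> 0" using trace_nonneg[OF P] by (simp add: t_def)
  have diag: "Re (cinner z (P z)) \<le> t * (norm z)\<^sup>2" for z
  proof (cases "z = 0")
    case True
    then show ?thesis by (simp add: cinner.zero_left)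
  next
    case False
    define u where "u = complex_of_real (1 / norm z) *\<^sub>C z"
    have z: "z = complex_of_real (norm z) *\<^sub>C u"
      using False by (simp add: u_def scaleC_scaleC scaleC_one)
    have "norm u = 1"
      using False by (simp add: u_def norm_scaleC norm_divide)
    then have "orthonormal {u}" by (simp add: orthonormal_def)
    from orthonormal_sum_le_trace[OF P this] have "Re (cinner u (P u)) \<le> t"
      by (simp add: t_def)
    moreover have "cinner z (P z) = complex_of_real ((norm z)\<^sup>2) * cinner u (P u)"
      by (subst (1 2) z)
        (simp add: bounded_clinear_scaleC[OF positive_op_clinear[OF positive_finite_trace_positive[OF P]]]
          cinner_scaleC_left cinner_scaleC_right power2_eq_square)
    ultimately show ?thesis
      using mult_right_mono[of "Re (cinner u (P u))" t "(norm z)\<^sup>2"]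
      by (simp add: mult.commute del: of_real_power)
  qed
  have "(cmod (cinner x (P y)))\<^sup>2 \<le> Re (cinner x (P x)) * Re (cinner y (P y))"
    by (rule positive_op_cauchy_schwarz[OF positive_finite_trace_positive[OF P]])
  also have "\<dots> \<le> (t * (norm x)\<^sup>2) * (t * (norm y)\<^sup>2)"
    using t by (intro mult_mono diag positive_op_nonneg positive_finite_trace_positive P) auto
  also have "\<dots> = (t * norm x * norm y)\<^sup>2"
    by (simp add: power2_eq_square)
  finally show ?thesis
    unfolding t_def[symmetric] by (rule power2_le_imp_le) (simp add: t)
qed

text \<open>Take the Cholesky decomposition for finitely many basis vectors that carry all but d of
  the trace. The remainder vanishes on them and lies below \<open>P\<close> elsewhere, so at most d
  of the trace is left to it.\<close>

lemma finite_rank_approx: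
  assumes P: "positive_finite_trace P" and "d > 0"
  obtains n v R where "positive_finite_trace R" "Re (op_trace R) \<le> d"
    "P = (\<lambda>x. (\<Sum>i<n::nat. outer (v i) (v i) x) + R x)"
proof -
  obtain F where F: "finite F" "F \<subseteq> onb" "Re (op_trace P) \<le> (\<Sum>b\<in>F. Re (cinner b (P b))) + d"
    using trace_approx[OF assms] .
  obtain n :: nat and v R where R: "positive_op R" and PR: "\<And>x. P x = (\<Sum>i<n. outer (v i) (v i) x) + R x"
    and RF: "\<And>b. b \<in> F \<Longrightarrow> R b = 0"
    using cholesky[OF positive_finite_trace_positive[OF P] F(1)] by blast
  have le: "Re (cinner x (R x)) \<le> Re (cinner x (P x))" for x
    by (simp add: PR cinner_add_right cinner.sum_right cinner_outer_self sum_nonneg)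
  have "(\<Sum>e\<in>F'. Re (cinner e (R e))) \<le> d" if F': "finite F'" "F' \<subseteq> onb" for F'
  proof -
    have "(\<Sum>e\<in>F'. Re (cinner e (R e))) = (\<Sum>e\<in>F' - F. Re (cinner e (R e)))"
      using F' RF by (intro sum.mono_neutral_right) (auto simp: cinner.zero_right)
    also have "\<dots> \<le> (\<Sum>e\<in>F' - F. Re (cinner e (P e)))"
      by (intro sum_mono le)
    also have "\<dots> = (\<Sum>e\<in>F' \<union> F. Re (cinner e (P e))) - (\<Sum>e\<in>F. Re (cinner e (P e)))"
      using F F' by (simp add: sum_diff[symmetric] Un_Diff)
    also have "\<dots> \<le> d"
      using onb_sum_le_trace[OF P, of "F' \<union> F"] F F' by simp
    finally show ?thesis .
  qed
  from positive_finite_traceI[OF R this] PR show ?thesis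
    by (intro that[of R v n]) auto
qed

section \<open>The trace class as a complex vector space\<close>

lemma trace_class_positive:
  assumes "positive_finite_trace P"
  shows "trace_class P"
  unfolding trace_class_def
  by (rule exI[of _ P], (rule exI[of _ "\<lambda>x. 0"])+)
    (use assms in \<open>simp add: positive_finite_trace_zero scaleC_zero_right\<close>)

lemma trace_class_plus:
  assumes "trace_class X" "trace_class Y"
  shows "trace_class (\<lambda>x. X x + Y x)"
proof -
  obtain P Q R S where pos: "positive_finite_trace P" "positive_finite_trace Q"
      "positive_finite_trace R" "positive_finite_trace S"
    and X: "X = (\<lambda>x. (P x - Q x) + \<i> *\<^sub>C (R x - S x))"
    using assms(1) unfolding trace_class_def by blast
  obtain P' Q' R' S' where pos': "positive_finite_trace P'" "positive_finite_trace Q'"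
      "positive_finite_trace R'" "positive_finite_trace S'"
    and Y: "Y = (\<lambda>x. (P' x - Q' x) + \<i> *\<^sub>C (R' x - S' x))"
    using assms(2) unfolding trace_class_def by blast
  show ?thesis
    unfolding trace_class_def
    by (rule exI[of _ "\<lambda>x. P x + P' x"], rule exI[of _ "\<lambda>x. Q x + Q' x"],
        rule exI[of _ "\<lambda>x. R x + R' x"], rule exI[of _ "\<lambda>x. S x + S' x"])
      (use pos pos' in \<open>simp add: positive_finite_trace_plus X Y scaleC_diff_right scaleC_add_right
         fun_eq_iff algebra_simps\<close>)
qed

lemma trace_class_real_scale:
  assumes "trace_class X"
  shows "trace_class (\<lambda>x. complex_of_real r *\<^sub>C X x)"
proof -
  obtain P Q R S where pos: "positive_finite_trace P" "positive_finite_trace Q"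
      "positive_finite_trace R" "positive_finite_trace S"
    and X: "X = (\<lambda>x. (P x - Q x) + \<i> *\<^sub>C (R x - S x))"
    using assms(1) unfolding trace_class_def by blast
  show ?thesis
  proof (cases "r \<ge> 0")
    case True
    then show ?thesis
      unfolding trace_class_def
      by (intro exI[of _ "\<lambda>x. complex_of_real r *\<^sub>C P x"] exI[of _ "\<lambda>x. complex_of_real r *\<^sub>C Q x"]
          exI[of _ "\<lambda>x. complex_of_real r *\<^sub>C R x"] exI[of _ "\<lambda>x. complex_of_real r *\<^sub>C S x"])
        (use pos in \<open>simp add: positive_finite_trace_scale X scaleC_diff_right scaleC_add_right
           scaleC_scaleC mult.commute\<close>)
  next
    case False
    \<comment> \<open>For negative r the positive and negative parts exchange their roles, each
      scaled by \<open>- r\<close>.\<close>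
    let ?s = "complex_of_real (- r)"
    have "complex_of_real r *\<^sub>C x = - (?s *\<^sub>C x)" for x :: 'a
      by (simp add: scaleC_minus_left)
    then have "complex_of_real r *\<^sub>C X x = (?s *\<^sub>C Q x - ?s *\<^sub>C P x) + \<i> *\<^sub>C (?s *\<^sub>C S x - ?s *\<^sub>C R x)" for x
      by (simp add: X scaleC_diff_right scaleC_add_right scaleC_scaleC scaleC_minus_left
          scaleC_minus_right mult.commute)
    then show ?thesis
      unfolding trace_class_def
      by (intro exI[of _ "\<lambda>x. ?s *\<^sub>C Q x"] exI[of _ "\<lambda>x. ?s *\<^sub>C P x"]
          exI[of _ "\<lambda>x. ?s *\<^sub>C S x"] exI[of _ "\<lambda>x. ?s *\<^sub>C R x"])
        (use pos False in \<open>simp add: positive_finite_trace_scale del: of_real_minus\<close>)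
  qed
qed

lemma trace_class_i_scale:
  assumes "trace_class X"
  shows "trace_class (\<lambda>x. \<i> *\<^sub>C X x)"
proof -
  obtain P Q R S where pos: "positive_finite_trace P" "positive_finite_trace Q"
      "positive_finite_trace R" "positive_finite_trace S"
    and X: "X = (\<lambda>x. (P x - Q x) + \<i> *\<^sub>C (R x - S x))"
    using assms(1) unfolding trace_class_def by blast
  have "\<i> *\<^sub>C X x = (S x - R x) + \<i> *\<^sub>C (P x - Q x)" for x
    by (simp add: X scaleC_add_right scaleC_scaleC scaleC_minus_left scaleC_one)
  then show ?thesis
    unfolding trace_class_def using pos by blast
qed

lemma trace_class_scale:
  assumes "trace_class X"
  shows "trace_class (\<lambda>x. c *\<^sub>C X x)"
proof -
  have "c *\<^sub>C X x = complex_of_real (Re c) *\<^sub>C X x + \<i> *\<^sub>C (complex_of_real (Im c) *\<^sub>C X x)" for x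
    unfolding scaleC_scaleC scaleC_add_left[symmetric] by (simp add: complex_eq[symmetric])
  then show ?thesis
    using trace_class_plus[OF trace_class_real_scale trace_class_i_scale[OF trace_class_real_scale], OF assms assms]
    by simp
qed

text \<open>Reduces assertions compatible with sums and multiples to positive operators, the only
  ones for which trace estimates are at hand. The differences in \<open>trace_class\<close> become
  multiples by -1.\<close>

lemma trace_class_induct [consumes 1, case_names positive plus scale]:
  assumes "trace_class X"
    and pos: "\<And>P. positive_finite_trace P \<Longrightarrow> \<Phi> P"
    and plus: "\<And>X Y. \<lbrakk>trace_class X; trace_class Y; \<Phi> X; \<Phi> Y\<rbrakk> \<Longrightarrow> \<Phi> (\<lambda>x. X x + Y x)"
    and scale: "\<And>c X. \<lbrakk>trace_class X; \<Phi> X\<rbrakk> \<Longrightarrow> \<Phi> (\<lambda>x. c *\<^sub>C X x)"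
  shows "\<Phi> X"
proof -
  obtain P Q R S where PQRS: "positive_finite_trace P" "positive_finite_trace Q"
      "positive_finite_trace R" "positive_finite_trace S"
    and X: "X = (\<lambda>x. (P x - Q x) + \<i> *\<^sub>C (R x - S x))"
    using assms(1) unfolding trace_class_def by blast
  have *: "trace_class X \<and> \<Phi> X \<Longrightarrow> trace_class Y \<and> \<Phi> Y \<Longrightarrow>
      trace_class (\<lambda>x. X x + Y x) \<and> \<Phi> (\<lambda>x. X x + Y x)"
    "trace_class X \<and> \<Phi> X \<Longrightarrow> trace_class (\<lambda>x. c *\<^sub>C X x) \<and> \<Phi> (\<lambda>x. c *\<^sub>C X x)" for X Y c
    using trace_class_plus trace_class_scale plus scale by blast+
  have **: "trace_class P \<and> \<Phi> P" if "positive_finite_trace P" for P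
    using that pos trace_class_positive by blast
  have "trace_class (\<lambda>x. (P x + (- 1) *\<^sub>C Q x) + \<i> *\<^sub>C (R x + (- 1) *\<^sub>C S x)) \<and>
      \<Phi> (\<lambda>x. (P x + (- 1) *\<^sub>C Q x) + \<i> *\<^sub>C (R x + (- 1) *\<^sub>C S x))"
    by (intro *(1) *(2) ** PQRS)
  then show ?thesis
    by (simp add: X scaleC_minus_left scaleC_one)
qed

lemma trace_class_clinear: "trace_class X \<Longrightarrow> bounded_clinear X"
  by (induction rule: trace_class_induct)
    (auto intro: bounded_clinear_plus bounded_clinear_cmult positive_op_clinear positive_finite_trace_positive)

lemma trace_class_summable: "trace_class X \<Longrightarrow> (\<lambda>e. cinner e (X e)) summable_on onb"
  by (induction rule: trace_class_induct)
    (auto simp: positive_finite_trace_def cinner_add_right cinner_scaleC_right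
      intro: summable_on_add summable_on_cmult_right)

lemma op_trace_plus:
  "trace_class X \<Longrightarrow> trace_class Y \<Longrightarrow> op_trace (\<lambda>x. X x + Y x) = op_trace X + op_trace Y"
  unfolding op_trace_def by (simp add: cinner_add_right infsum_add trace_class_summable)

lemma op_trace_scale:
  "trace_class X \<Longrightarrow> op_trace (\<lambda>x. c *\<^sub>C X x) = c * op_trace X"
  unfolding op_trace_def by (simp add: cinner_scaleC_right infsum_cmult_right trace_class_summable)

text \<open>Polarization; the factor 1/2 enters each rank-one term through both vectors and yields
  the usual 1/4.\<close>

lemma trace_class_outer: "trace_class (outer v w)"
proof -
  define h where "h = complex_of_real (1 / 2)"
  have "outer v w x = (outer (h *\<^sub>C (v + w)) (h *\<^sub>C (v + w)) x - outer (h *\<^sub>C (v - w)) (h *\<^sub>C (v - w)) x)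
      + \<i> *\<^sub>C (outer (h *\<^sub>C (v + \<i> *\<^sub>C w)) (h *\<^sub>C (v + \<i> *\<^sub>C w)) x
        - outer (h *\<^sub>C (v - \<i> *\<^sub>C w)) (h *\<^sub>C (v - \<i> *\<^sub>C w)) x)" for x
  proof (rule cinner_right_eqI)
    fix y
    show "cinner y (outer v w x) = cinner y ((outer (h *\<^sub>C (v + w)) (h *\<^sub>C (v + w)) x
        - outer (h *\<^sub>C (v - w)) (h *\<^sub>C (v - w)) x)
      + \<i> *\<^sub>C (outer (h *\<^sub>C (v + \<i> *\<^sub>C w)) (h *\<^sub>C (v + \<i> *\<^sub>C w)) x
        - outer (h *\<^sub>C (v - \<i> *\<^sub>C w)) (h *\<^sub>C (v - \<i> *\<^sub>C w)) x))"
      unfolding cinner_add_right cinner_scaleC_right cinner.diff_right cinner_outer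
        cinner_add_left cinner_scaleC_left cinner.diff_left
      by (simp add: h_def algebra_simps)
  qed
  then show ?thesis
    unfolding trace_class_def using positive_finite_trace_outer by blast
qed


section \<open>Unitary conjugation\<close>

text \<open>A unitary is injective because it is isometric, and its inverse satisfies the relation
  in the description \<open>cadjoint\<close>, whose solution is unique by nondegeneracy of the inner
  product.\<close>

lemma unitary_cadjoint:
  assumes V: "unitary_op V"
  shows unitary_cadjoint_right: "V (cadjoint V x) = x"
    and unitary_cadjoint_left: "cadjoint V (V x) = x"
    and cinner_cadjoint: "cinner (cadjoint V x) y = cinner x (V y)"
proof -
  have lin: "bounded_clinear V" and surj: "surj V" and iso: "\<And>x y. cinner (V x) (V y) = cinner x y"
    using V by (auto simp: unitary_op_def)
  have inj: "inj V"
  proof (rule injI)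
    fix x y assume "V x = V y"
    then have "cinner (x - y) (x - y) = 0"
      using iso[of "x - y" "x - y"] by (simp add: bounded_clinear_diff[OF lin] cinner.zero_left)
    then show "x = y" by (simp add: norm_cinner)
  qed
  have ad: "cinner (inv_into UNIV V x) y = cinner x (V y)" for x y
    using iso[of "inv_into UNIV V x" y] surj by (simp add: surj_f_inv_f)
  have "cadjoint V = inv_into UNIV V"
    unfolding cadjoint_def
  proof (rule the_equality)
    fix Y assume Y: "\<forall>x y. cinner (Y x) y = cinner x (V y)"
    show "Y = inv_into UNIV V"
    proof (rule op_eqI)
      show "cinner x (Y y) = cinner x (inv_into UNIV V y)" for x y
        using Y ad by (metis cinner_commute)
    qed
  qed (use ad in blast)
  then show "V (cadjoint V x) = x" "cadjoint V (V x) = x" "cinner (cadjoint V x) y = cinner x (V y)"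
    using ad surj inj by (simp_all add: surj_f_inv_f)
qed

lemma unitary_norm:
  assumes "unitary_op V"
  shows "norm (V x) = norm x"
proof -
  have "cinner (V x) (V x) = cinner x x"
    using assms by (simp add: unitary_op_def)
  then have "(norm (V x))\<^sup>2 = (norm x)\<^sup>2"
    unfolding norm_cinner of_real_eq_iff .
  then show ?thesis
    by (rule power2_eq_imp_eq) simp_all
qed

lemma unitary_op_cadjoint:
  assumes V: "unitary_op V"
  shows "unitary_op (cadjoint V)"
proof -
  note ad = cinner_cadjoint[OF V]
  have ad': "cinner y (cadjoint V x) = cinner (V y) x" for x y
    using ad[of x y] cinner_commute[of y] cinner_commute[of "V y"] by simp
  have iso: "cinner (cadjoint V x) (cadjoint V y) = cinner x y" for x y
    by (simp add: ad unitary_cadjoint_right[OF V])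
  have add: "cadjoint V (x + y) = cadjoint V x + cadjoint V y" for x y
    by (rule cinner_right_eqI) (simp add: ad' cinner_add_right)
  have scale: "cadjoint V (c *\<^sub>C x) = c *\<^sub>C cadjoint V x" for c x
    by (rule cinner_right_eqI) (simp add: ad' cinner_scaleC_right)
  have "norm (cadjoint V x) = norm x" for x
    using unitary_norm[OF V, of "cadjoint V x"] by (simp add: unitary_cadjoint_right[OF V])
  then have "bounded_linear (cadjoint V)"
    by (intro bounded_linear_intro[of "cadjoint V" 1]) (simp_all add: add scale scaleC_of_real[symmetric])
  moreover have "surj (cadjoint V)"
    using unitary_cadjoint_left[OF V] by (rule surjI)
  ultimately show ?thesis
    using iso scale by (simp add: unitary_op_def bounded_clinear_def)
qed

lemma cadjoint_cadjoint:
  assumes V: "unitary_op V"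
  shows "cadjoint (cadjoint V) = V"
proof
  fix x
  show "cadjoint (cadjoint V) x = V x"
    using unitary_cadjoint_left[OF unitary_op_cadjoint[OF V], of "V x"] by (simp add: unitary_cadjoint_left[OF V])
qed

lemma cinner_cadjoint_right:
  assumes "unitary_op V"
  shows "cinner x (V y) = cinner (cadjoint V x) y" "cinner (V x) y = cinner x (cadjoint V y)"
  using cinner_cadjoint[OF assms, of x y] cinner_cadjoint[OF assms, of y x] cinner_commute by metis+

lemma unitary_orthonormal_image:
  assumes V: "unitary_op V" and F: "orthonormal F"
  shows "orthonormal (V ` F)" and unitary_inj_on: "inj_on V F"
proof -
  show "inj_on V F"
    by (rule inj_on_inverseI[of _ "cadjoint V"]) (simp add: unitary_cadjoint_left[OF V])
  then show "orthonormal (V ` F)"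
    using F V unitary_norm[OF V] by (auto simp: orthonormal_def unitary_op_def)
qed

text \<open>\<open>V\<close> carries \<open>F\<close> to an orthonormal set that need not lie in
  \<open>onb\<close>; this is where the trace inequality for arbitrary orthonormal sets pays
  off.\<close>

lemma unitary_sum_le_trace:
  assumes V: "unitary_op V" and P: "positive_finite_trace P" and F: "finite F" "F \<subseteq> onb"
  shows "(\<Sum>e\<in>F. Re (cinner (V e) (P (V e)))) \<le> Re (op_trace P)"
proof -
  have on: "orthonormal F"
    using orthonormal_subset[OF is_onb_orthonormal[OF is_onb_onb] F(2)] .
  have "(\<Sum>b\<in>V ` F. Re (cinner b (P b))) \<le> Re (op_trace P)"
    using unitary_orthonormal_image[OF V on] F(1) by (intro orthonormal_sum_le_trace[OF P]) auto
  then show ?thesis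
    unfolding sum.reindex[OF unitary_inj_on[OF V on]] by (simp add: comp_def)
qed

lemma conj_positive:
  assumes V: "unitary_op V" and P: "positive_finite_trace P"
  shows conj_positive_finite_trace: "positive_finite_trace (V \<circ> P \<circ> cadjoint V)"
    and trace_conj_le: "Re (op_trace (V \<circ> P \<circ> cadjoint V)) \<le> Re (op_trace P)"
proof -
  have form: "cinner x ((V \<circ> P \<circ> cadjoint V) y) = cinner (cadjoint V x) (P (cadjoint V y))" for x y
    by (simp add: cinner_cadjoint_right[OF V])
  have lin: "bounded_clinear V" "bounded_clinear (cadjoint V)"
    using V unitary_op_cadjoint[OF V] by (auto simp: unitary_op_def)
  have "positive_op (V \<circ> P \<circ> cadjoint V)"
    unfolding positive_op_def form using positive_finite_trace_positive[OF P] lin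
    by (auto simp: positive_op_def intro: bounded_clinear_compose)
  moreover have "(\<Sum>e\<in>F. Re (cinner e ((V \<circ> P \<circ> cadjoint V) e))) \<le> Re (op_trace P)"
    if F: "finite F" "F \<subseteq> onb" for F
    unfolding form by (rule unitary_sum_le_trace[OF unitary_op_cadjoint[OF V] P F])
  ultimately show "positive_finite_trace (V \<circ> P \<circ> cadjoint V)"
    "Re (op_trace (V \<circ> P \<circ> cadjoint V)) \<le> Re (op_trace P)"
    using positive_finite_traceI by blast+
qed

text \<open>Conjugating back with the adjoint reverses the inequality
  \<open>trace_conj_le\<close>.\<close>

lemma trace_conj:
  assumes V: "unitary_op V" and P: "positive_finite_trace P"
  shows "op_trace (V \<circ> P \<circ> cadjoint V) = op_trace P"
proof -
  have "cadjoint V \<circ> (V \<circ> P \<circ> cadjoint V) \<circ> cadjoint (cadjoint V) = P"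
    by (rule ext) (simp add: cadjoint_cadjoint[OF V] unitary_cadjoint_left[OF V])
  then have "Re (op_trace P) \<le> Re (op_trace (V \<circ> P \<circ> cadjoint V))"
    using trace_conj_le[OF unitary_op_cadjoint[OF V] conj_positive_finite_trace[OF assms]] by simp
  then show ?thesis
    using trace_conj_le[OF assms] positive_finite_trace_Im[OF P]
      positive_finite_trace_Im[OF conj_positive_finite_trace[OF assms]] by (simp add: complex_eq_iff)
qed


lemma trace_class_conj:
  assumes V: "unitary_op V" and "trace_class X"
  shows "trace_class (V \<circ> X \<circ> cadjoint V)"
  using assms(2)
proof (induction rule: trace_class_induct)
  case (positive P)
  then show ?case
    by (intro trace_class_positive conj_positive_finite_trace[OF V])
next
  case (plus X Y)
  have eq: "V \<circ> (\<lambda>x. X x + Y x) \<circ> cadjoint V = (\<lambda>x. (V \<circ> X \<circ> cadjoint V) x + (V \<circ> Y \<circ> cadjoint V) x)"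
    using V by (simp add: fun_eq_iff unitary_op_def bounded_clinear_add)
  show ?case
    unfolding eq by (rule trace_class_plus[OF plus.IH])
next
  case (scale c X)
  have eq: "V \<circ> (\<lambda>x. c *\<^sub>C X x) \<circ> cadjoint V = (\<lambda>x. c *\<^sub>C (V \<circ> X \<circ> cadjoint V) x)"
    using V by (simp add: fun_eq_iff unitary_op_def bounded_clinear_scaleC)
  show ?case
    unfolding eq by (rule trace_class_scale[OF scale.IH])
qed


section \<open>Bounds for channels\<close>

lemma channel_trace_class: "quantum_channel E \<Longrightarrow> trace_class X \<Longrightarrow> trace_class (E X)"
  and channel_plus: "quantum_channel E \<Longrightarrow> trace_class X \<Longrightarrow> trace_class Y \<Longrightarrow>
    E (\<lambda>x. X x + Y x) = (\<lambda>x. E X x + E Y x)"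
  and channel_scale: "quantum_channel E \<Longrightarrow> trace_class X \<Longrightarrow> E (\<lambda>x. c *\<^sub>C X x) = (\<lambda>x. c *\<^sub>C E X x)"
  and channel_trace: "quantum_channel E \<Longrightarrow> trace_class X \<Longrightarrow> op_trace (E X) = op_trace X"
  and channel_positive_block: "quantum_channel E \<Longrightarrow> (\<And>i j. i < n \<Longrightarrow> j < n \<Longrightarrow> trace_class (Z i j)) \<Longrightarrow>
    positive_block n Z \<Longrightarrow> positive_block n (\<lambda>i j. E (Z i j))"
  by (simp_all add: quantum_channel_def linear_map_def trace_preserving_def completely_positive_def)

lemma channel_positive:
  assumes E: "quantum_channel E" and P: "positive_finite_trace P"
  shows "positive_finite_trace (E P)"
proof -
  have tc: "trace_class P" by (rule trace_class_positive[OF P])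
  have "positive_block 1 (\<lambda>i j. P)"
    using positive_finite_trace_positive[OF P] by (simp add: positive_block_def positive_op_def)
  then have block: "positive_block 1 (\<lambda>i j. E P)"
    by (rule channel_positive_block[OF E tc])
  have "cinner x (E P x) \<in> \<real>\<^sub>\<ge>\<^sub>0" for x
    using spec[OF block[unfolded positive_block_def], of "\<lambda>_. x"] by simp
  then show ?thesis
    using trace_class_clinear[OF channel_trace_class[OF E tc]] trace_class_summable[OF channel_trace_class[OF E tc]]
    by (simp add: positive_finite_trace_def positive_op_def)
qed

lemma channel_positive_bound:
  assumes E: "quantum_channel E" and P: "positive_finite_trace P"
  shows "cmod (cinner x (E P y)) \<le> Re (op_trace P) * norm x * norm y"
  using positive_finite_trace_bound[OF channel_positive[OF assms], of x y]
  by (simp add: channel_trace[OF E trace_class_positive[OF P]])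

text \<open>Here complete positivity, for two by two blocks, replaces the trace norm estimate for \<open>E\<close>.\<close>

lemma channel_outer_bound:
  assumes E: "quantum_channel E"
  shows "cmod (cinner x (E (outer v w) y)) \<le> norm v * norm w * norm x * norm y"
proof -
  \<comment> \<open>The operators \<open>outer (u i) (u j)\<close> form the block matrix of |u><u|
    for the column u = (v, w), so its quadratic form is a square modulus.\<close>
  define u where "u i = (if i = 0 then v else w)" for i :: nat
  have "positive_block 2 (\<lambda>i j. outer (u i) (u j))"
    unfolding positive_block_def
  proof
    fix \<xi> :: "nat \<Rightarrow> 'a"
    define z where "z = (\<Sum>j<2. cinner (u j) (\<xi> j))"
    have "(\<Sum>i<2. \<Sum>j<2. cinner (\<xi> i) (outer (u i) (u j) (\<xi> j))) = cnj z * z"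
      unfolding z_def cnj_sum by (simp add: cinner_outer cinner_cnj sum_product)
    also have "\<dots> = complex_of_real ((cmod z)\<^sup>2)"
      unfolding complex_norm_square by (rule mult.commute)
    finally show "(\<Sum>i<2. \<Sum>j<2. cinner (\<xi> i) (outer (u i) (u j) (\<xi> j))) \<in> \<real>\<^sub>\<ge>\<^sub>0"
      by (simp del: of_real_power)
  qed
  then have block: "positive_block 2 (\<lambda>i j. E (outer (u i) (u j)))"
    by (intro channel_positive_block[OF E] trace_class_outer)
  have lin: "bounded_clinear (E (outer a b))" for a b
    by (intro trace_class_clinear channel_trace_class[OF E] trace_class_outer)
  \<comment> \<open>Testing the image block matrix on the pair (s x, t y) gives a two by two form
    with the wanted element off the diagonal.\<close>
  have form: "cnj s * s * cinner x (E (outer v v) x) + cnj s * t * cinner x (E (outer v w) y)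
      + cnj t * s * cinner y (E (outer w v) x) + cnj t * t * cinner y (E (outer w w) y) \<in> \<real>\<^sub>\<ge>\<^sub>0" for s t
    using block[unfolded positive_block_def, rule_format, of "\<lambda>i. if i = 0 then s *\<^sub>C x else t *\<^sub>C y"]
    by (simp add: numeral_2_eq_2 u_def bounded_clinear_scaleC[OF lin] cinner_scaleC_left cinner_scaleC_right
        algebra_simps)
  have diag: "Re (cinner z (E (outer a a) z)) \<le> (norm a * norm z)\<^sup>2"
    "0 \<le> Re (cinner z (E (outer a a) z))" for a z
  proof -
    have P: "positive_finite_trace (outer a a)"
      by (rule positive_finite_trace_outer)
    have "Re (cinner z (E (outer a a) z)) \<le> Re (op_trace (outer a a)) * norm z * norm z"
      using channel_positive_bound[OF E P, of z z] complex_Re_le_cmod order_trans by blast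
    also have "\<dots> \<le> (norm a)\<^sup>2 * norm z * norm z"
      by (intro mult_right_mono trace_outer_le) auto
    also have "\<dots> = (norm a * norm z)\<^sup>2"
      by (simp add: power2_eq_square)
    finally show "Re (cinner z (E (outer a a) z)) \<le> (norm a * norm z)\<^sup>2" .
    show "0 \<le> Re (cinner z (E (outer a a) z))"
      by (intro positive_op_nonneg positive_finite_trace_positive channel_positive[OF E P])
  qed
  have "(cmod (cinner x (E (outer v w) y)))\<^sup>2 \<le> Re (cinner x (E (outer v v) x)) * Re (cinner y (E (outer w w) y))"
    by (rule nonneg_form2_le[OF form])
  also have "\<dots> \<le> (norm v * norm x)\<^sup>2 * (norm w * norm y)\<^sup>2"
    by (intro mult_mono diag) auto
  also have "\<dots> = (norm v * norm w * norm x * norm y)\<^sup>2"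
    by (simp add: power2_eq_square)
  finally show ?thesis
    by (rule power2_le_imp_le) simp
qed

lemma outer_diff_left: "outer (v - v') w = (\<lambda>x. outer v w x + (- 1) *\<^sub>C outer v' w x)"
  and outer_diff_right: "outer v (w - w') = (\<lambda>x. outer v w x + (- 1) *\<^sub>C outer v w' x)"
  by (simp_all add: outer_def fun_eq_iff scaleC_diff_right scaleC_diff_left cinner.diff_left
      scaleC_minus_left scaleC_one)

text \<open>The expression is additive in each of its four vectors and bounded by the product of
  their norms. Replacing the vectors by their limits one at a time bounds the difference by
  \<open>?h\<close>, which tends to 0.\<close>

lemma channel_outer_tendsto:
  assumes E: "quantum_channel E"
    and lim: "(x \<longlongrightarrow> x0) F" "(v \<longlongrightarrow> v0) F" "(w \<longlongrightarrow> w0) F" "(y \<longlongrightarrow> y0) F"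
  shows "((\<lambda>g. cinner (x g) (E (outer (v g) (w g)) (y g))) \<longlongrightarrow> cinner x0 (E (outer v0 w0) y0)) F"
proof -
  define B where "B a b c d = cinner a (E (outer b c) d)" for a b c d
  have lin: "bounded_clinear (E (outer a b))" for a b
    by (intro trace_class_clinear channel_trace_class[OF E] trace_class_outer)
  have B1: "B (a - a') b c d = B a b c d - B a' b c d" for a a' b c d
    by (simp add: B_def cinner.diff_left)
  have B2: "B a (b - b') c d = B a b c d - B a b' c d" for a b b' c d
    by (simp add: B_def outer_diff_left channel_plus[OF E trace_class_outer trace_class_scale[OF trace_class_outer]]
        channel_scale[OF E trace_class_outer] cinner_add_right cinner_scaleC_right)
  have B3: "B a b (c - c') d = B a b c d - B a b c' d" for a b c c' d
    by (simp add: B_def outer_diff_right channel_plus[OF E trace_class_outer trace_class_scale[OF trace_class_outer]]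
        channel_scale[OF E trace_class_outer] cinner_add_right cinner_scaleC_right)
  have B4: "B a b c (d - d') = B a b c d - B a b c d'" for a b c d d'
    by (simp add: B_def bounded_clinear_diff[OF lin] cinner.diff_right)
  have bound: "norm (B a b c d) \<le> norm b * norm c * norm a * norm d" for a b c d
    unfolding B_def using channel_outer_bound[OF E] by simp
  let ?h = "\<lambda>g. norm (v g) * norm (w g) * norm (x g - x0) * norm (y g)
      + norm (v g - v0) * norm (w g) * norm x0 * norm (y g)
      + norm v0 * norm (w g - w0) * norm x0 * norm (y g)
      + norm v0 * norm w0 * norm x0 * norm (y g - y0)"
  have le: "norm (B (x g) (v g) (w g) (y g) - B x0 v0 w0 y0) \<le> ?h g" for g
  proof -
    have "B (x g) (v g) (w g) (y g) - B x0 v0 w0 y0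
      = B (x g - x0) (v g) (w g) (y g) + B x0 (v g - v0) (w g) (y g)
        + B x0 v0 (w g - w0) (y g) + B x0 v0 w0 (y g - y0)"
      by (simp add: B1 B2 B3 B4)
    then show ?thesis
      by (auto intro!: order_trans[OF norm_triangle_ineq] add_mono bound)
  qed
  have "(?h \<longlongrightarrow> norm v0 * norm w0 * norm (x0 - x0) * norm y0
      + norm (v0 - v0) * norm w0 * norm x0 * norm y0
      + norm v0 * norm (w0 - w0) * norm x0 * norm y0
      + norm v0 * norm w0 * norm x0 * norm (y0 - y0)) F"
    by (intro tendsto_intros lim)
  then have lim0: "(?h \<longlongrightarrow> 0) F" by simp
  have "((\<lambda>g. B (x g) (v g) (w g) (y g) - B x0 v0 w0 y0) \<longlongrightarrow> 0) F"
    by (rule Lim_null_comparison[OF _ lim0]) (simp add: le)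
  then show ?thesis
    unfolding B_def by (simp only: Lim_null[symmetric])
qed


section \<open>The twirled channel\<close>

lemma (in compact_group) ccont_uniform_limit:
  assumes approx: "\<And>d. d > 0 \<Longrightarrow> \<exists>h. ccont h \<and> (\<forall>g\<in>carrier G. cmod (f g - h g) \<le> d)"
  shows "ccont f"
proof -
  have "continuous_map T Met_TC.mtopology f"
    unfolding Met_TC.continuous_map_to_metric
  proof (intro ballI allI impI)
    fix g0 and d :: real assume g0: "g0 \<in> topspace T" and "d > 0"
    then obtain h where h: "ccont h" and near: "\<And>g. g \<in> carrier G \<Longrightarrow> cmod (f g - h g) \<le> d / 4"
      using approx[of "d / 4"] by auto
    let ?W = "{g \<in> topspace T. h g \<in> ball (h g0) (d / 4)}"
    have "openin T ?W"
      using h by (rule openin_continuous_map_preimage) simp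
    moreover have "g0 \<in> ?W"
      using g0 \<open>d > 0\<close> by simp
    moreover have "f g \<in> Met_TC.mball (f g0) d" if "g \<in> ?W" for g
    proof -
      have "dist (f g0) (h g0) \<le> d / 4" "dist (h g0) (h g) < d / 4" "dist (h g) (f g) \<le> d / 4"
        using that near[of g0] near[of g] g0 by (auto simp: topspace_eq dist_norm norm_minus_commute)
      then have "dist (f g0) (f g) < d"
        using dist_triangle[of "f g0" "f g" "h g0"] dist_triangle[of "h g0" "f g" "h g"] \<open>d > 0\<close> by linarith
      then show ?thesis by simp
    qed
    ultimately show "\<exists>U. openin T U \<and> g0 \<in> U \<and> (\<forall>g\<in>U. f g \<in> Met_TC.mball (f g0) d)"
      by blast
  qed
  then show ?thesis by simp
qed

locale channel_twirl = compact_group G T for G :: "('a, 'm) monoid_scheme" (structure) and T +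
  fixes U :: "'a \<Rightarrow> 'h::chilbert_space \<Rightarrow> 'h" and E :: "('h \<Rightarrow> 'h) \<Rightarrow> 'h \<Rightarrow> 'h"
  assumes rep: "unitary_rep G U"
    and cont_rep: "strongly_continuous T U"
    and channel: "quantum_channel E"
begin

lemma unitary: "g \<in> carrier G \<Longrightarrow> unitary_op (U g)"
  using rep by (simp add: unitary_rep_def)

lemma rep_mult: "g \<in> carrier G \<Longrightarrow> h \<in> carrier G \<Longrightarrow> U (g \<otimes> h) x = U g (U h x)"
  using rep by (simp add: unitary_rep_def)

lemma lin: "g \<in> carrier G \<Longrightarrow> bounded_clinear (U g)"
  using unitary by (simp add: unitary_op_def)

lemma conj_op_trace_class: "g \<in> carrier G \<Longrightarrow> trace_class X \<Longrightarrow> trace_class (conj_op U g X)"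
  unfolding conj_op_def by (intro trace_class_conj unitary)

lemma conj_op_positive: "g \<in> carrier G \<Longrightarrow> positive_finite_trace P \<Longrightarrow> positive_finite_trace (conj_op U g P)"
  unfolding conj_op_def by (intro conj_positive_finite_trace unitary)

lemma conj_op_plus:
  "g \<in> carrier G \<Longrightarrow> conj_op U g (\<lambda>x. X x + Y x) = (\<lambda>x. conj_op U g X x + conj_op U g Y x)"
  by (simp add: conj_op_def fun_eq_iff bounded_clinear_add[OF lin])

lemma conj_op_scale:
  "g \<in> carrier G \<Longrightarrow> conj_op U g (\<lambda>x. c *\<^sub>C X x) = (\<lambda>x. c *\<^sub>C conj_op U g X x)"
  by (simp add: conj_op_def fun_eq_iff bounded_clinear_scaleC[OF lin])

lemma conj_op_outer: "g \<in> carrier G \<Longrightarrow> conj_op U g (outer v w) = outer (U g v) (U g w)"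
  by (simp add: conj_op_def fun_eq_iff outer_def bounded_clinear_scaleC[OF lin]
      cinner_cadjoint_right[OF unitary])

text \<open>The matrix element between x and y of the operator to be averaged, with its left factor,
  the adjoint of \<open>U g\<close>, moved over to x.\<close>

definition form :: "('h \<Rightarrow> 'h) \<Rightarrow> 'h \<Rightarrow> 'h \<Rightarrow> 'a \<Rightarrow> complex" where
  "form X x y g = cinner (U g x) (E (conj_op U g X) (U g y))"

lemma E_clinear: "g \<in> carrier G \<Longrightarrow> trace_class X \<Longrightarrow> bounded_clinear (E (conj_op U g X))"
  by (intro trace_class_clinear channel_trace_class[OF channel] conj_op_trace_class)

lemma form_plus:
  "\<lbrakk>g \<in> carrier G; trace_class X; trace_class Y\<rbrakk> \<Longrightarrow>
    form (\<lambda>x. X x + Y x) x y g = form X x y g + form Y x y g"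
  by (simp add: form_def conj_op_plus channel_plus[OF channel] conj_op_trace_class cinner_add_right)

lemma form_scale:
  "\<lbrakk>g \<in> carrier G; trace_class X\<rbrakk> \<Longrightarrow> form (\<lambda>x. c *\<^sub>C X x) x y g = c * form X x y g"
  by (simp add: form_def conj_op_scale channel_scale[OF channel] conj_op_trace_class cinner_scaleC_right)

lemma ccont_cong: "ccont f \<Longrightarrow> (\<And>g. g \<in> carrier G \<Longrightarrow> f g = f' g) \<Longrightarrow> ccont f'"
  by (rule continuous_map_eq[of T _ f]) (auto simp: topspace_eq)

lemma ccont_form_outer: "ccont (form (outer v w) x y)"
proof -
  have U: "((\<lambda>g. U g z) \<longlongrightarrow> U g0 z) (atin T g0)" if "g0 \<in> topspace T" for g0 z
    using cont_rep that unfolding strongly_continuous_def continuous_map_atin by simp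
  have "ccont (\<lambda>g. cinner (U g x) (E (outer (U g v) (U g w)) (U g y)))"
    unfolding continuous_map_atin by (auto intro!: channel_outer_tendsto[OF channel] U)
  then show ?thesis
    by (rule ccont_cong) (simp add: form_def conj_op_outer)
qed

lemma form_plus_ccont:
  assumes "trace_class X" "trace_class Y" "ccont (form X x y)" "ccont (form Y x y)"
  shows "ccont (form (\<lambda>x. X x + Y x) x y)"
  by (rule ccont_cong[OF ccont_add[OF assms(3,4)]]) (simp add: form_plus assms)

lemma form_scale_ccont:
  assumes "trace_class X" "ccont (form X x y)"
  shows "ccont (form (\<lambda>x. c *\<^sub>C X x) x y)"
  by (rule ccont_cong[OF ccont_cmult[OF assms(2), of c]]) (simp add: form_scale assms)

lemma form_positive_bound:
  assumes P: "positive_finite_trace P" and g: "g \<in> carrier G"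
  shows "cmod (form P x y g) \<le> Re (op_trace P) * norm x * norm y"
  using channel_positive_bound[OF channel conj_op_positive[OF g P], of "U g x" "U g y"]
    trace_conj[OF unitary[OF g] P]
  by (simp add: form_def unitary_norm[OF unitary[OF g]] conj_op_def)

text \<open>For |v><w| strong continuity suffices, as conjugation just moves v and w. A remainder of
  small trace contributes little, uniformly in g, since conjugation and the channel preserve its
  trace.\<close>

lemma ccont_form:
  assumes "trace_class X"
  shows "ccont (form X x y)"
  using assms
proof (induction rule: trace_class_induct)
  case (positive P)
  show ?case
  proof (rule ccont_uniform_limit)
    fix d :: real assume "d > 0"
    \<comment> \<open>A remainder of trace at most \<open>d / K\<close> changes the form by at most
      d; the summand 1 avoids division by zero.\<close>
    define K where "K = norm x * norm y + 1"
    have K: "K > 0" by (simp add: K_def add_nonneg_pos)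
    obtain v n R where R: "positive_finite_trace R" "Re (op_trace R) \<le> d / K"
      and P: "P = (\<lambda>x. (\<Sum>i<n::nat. outer (v i) (v i) x) + R x)"
      by (rule finite_rank_approx[OF positive, of "d / K"]) (use \<open>d > 0\<close> K in simp)
    define Q where "Q x = (\<Sum>i<n. outer (v i) (v i) x)" for x
    have "trace_class (\<lambda>x. \<Sum>i<m. outer (v i) (v i) x)
        \<and> ccont (form (\<lambda>x. \<Sum>i<m. outer (v i) (v i) x) x y)" for m
    proof (induction m)
      case 0
      have "(\<lambda>x. 0) = outer 0 (0 :: 'h)"
        by (simp add: outer_def fun_eq_iff scaleC_zero_right)
      then show ?case
        using trace_class_outer[of "0 :: 'h" 0] ccont_form_outer[of 0 0] by simp
    next
      case (Suc m)
      then show ?case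
        by (simp add: trace_class_plus form_plus_ccont trace_class_outer ccont_form_outer)
    qed
    then have Q: "trace_class Q" "ccont (form Q x y)"
      by (auto simp: Q_def[abs_def])
    have "cmod (form P x y g - form Q x y g) \<le> d" if g: "g \<in> carrier G" for g
    proof -
      have "form P x y g - form Q x y g = form R x y g"
        using form_plus[OF g Q(1) trace_class_positive[OF R(1)], of x y] by (simp add: P Q_def)
      also have "cmod \<dots> \<le> Re (op_trace R) * norm x * norm y"
        by (rule form_positive_bound[OF R(1) g])
      also have "\<dots> = Re (op_trace R) * (norm x * norm y)"
        by (simp add: mult.assoc)
      also have "\<dots> \<le> (d / K) * K"
        using R(2) trace_nonneg[OF R(1)] by (intro mult_mono) (auto simp: K_def intro: order_trans)
      finally show ?thesis using K by simp
    qed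
    with Q show "\<exists>h. ccont h \<and> (\<forall>g\<in>carrier G. cmod (form P x y g - h g) \<le> d)" by blast
  qed
qed (auto intro: form_plus_ccont form_scale_ccont)

lemma form_bound:
  assumes "trace_class X"
  shows "\<exists>K. \<forall>x y. \<forall>g\<in>carrier G. cmod (form X x y g) \<le> K * norm x * norm y"
  using assms
proof (induction rule: trace_class_induct)
  case (positive P)
  then show ?case
    using form_positive_bound by blast
next
  case (plus X Y)
  then obtain K L where K: "\<And>x y g. g \<in> carrier G \<Longrightarrow> cmod (form X x y g) \<le> K * norm x * norm y"
    and L: "\<And>x y g. g \<in> carrier G \<Longrightarrow> cmod (form Y x y g) \<le> L * norm x * norm y"
    by blast
  have "cmod (form (\<lambda>x. X x + Y x) x y g) \<le> (K + L) * norm x * norm y" if "g \<in> carrier G" for x y g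
    unfolding form_plus[OF that plus.hyps]
    using norm_triangle_le[OF add_mono[OF K[OF that] L[OF that]]] by (simp add: distrib_right)
  then show ?case by blast
next
  case (scale c X)
  then obtain K where K: "\<And>x y g. g \<in> carrier G \<Longrightarrow> cmod (form X x y g) \<le> K * norm x * norm y"
    by blast
  have "cmod (form (\<lambda>x. c *\<^sub>C X x) x y g) \<le> (cmod c * K) * norm x * norm y" if "g \<in> carrier G" for x y g
    unfolding form_scale[OF that scale.hyps] norm_mult
    using mult_left_mono[OF K[OF that] norm_ge_zero[of c]] by (simp add: mult.assoc)
  then show ?case by blast
qed

text \<open>Outside the trace class the choice may lack a witness; the value there is irrelevant to
  a channel.\<close>

definition twirl :: "('h \<Rightarrow> 'h) \<Rightarrow> 'h \<Rightarrow> 'h" where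
  "twirl X = (SOME Y. bounded_clinear Y \<and> (\<forall>x y. cinner x (Y y) = cmean (form X x y)))"

lemma twirl_spec:
  assumes X: "trace_class X"
  shows twirl_clinear: "bounded_clinear (twirl X)"
    and cinner_twirl: "cinner x (twirl X y) = cmean (form X x y)"
proof -
  note cont = ccont_form[OF X]
  obtain K where K: "\<And>x y g. g \<in> carrier G \<Longrightarrow> cmod (form X x y g) \<le> K * norm x * norm y"
    using form_bound[OF X] by blast
  have "\<exists>Y. bounded_clinear Y \<and> (\<forall>x y. cinner x (Y y) = cmean (form X x y))"
  proof (rule form_operator[of "\<lambda>x y. cmean (form X x y)" "2 * K"])
    fix x x' y c
    have "form X (x + x') y g = form X x y g + form X x' y g" if "g \<in> carrier G" for g
      by (simp add: form_def bounded_clinear_add[OF lin[OF that]] cinner_add_left)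
    then show "cmean (form X (x + x') y) = cmean (form X x y) + cmean (form X x' y)"
      using cmean_cong[OF cont, of "x + x'" y "\<lambda>g. form X x y g + form X x' y g"]
      by (simp add: cmean_add cont)
    have "form X (c *\<^sub>C x) y g = cnj c * form X x y g" if "g \<in> carrier G" for g
      by (simp add: form_def bounded_clinear_scaleC[OF lin[OF that]] cinner_scaleC_left)
    then show "cmean (form X (c *\<^sub>C x) y) = cnj c * cmean (form X x y)"
      using cmean_cong[OF cont, of "c *\<^sub>C x" y "\<lambda>g. cnj c * form X x y g"]
      by (simp add: cmean_cmult cont)
    show "cmod (cmean (form X x y)) \<le> 2 * K * norm x * norm y"
      using cmod_cmean_le[OF cont K] by (simp add: mult.assoc)
  next
    fix x y y' c
    have "form X x (y + y') g = form X x y g + form X x y' g" if "g \<in> carrier G" for g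
      by (simp add: form_def bounded_clinear_add[OF lin[OF that]]
          bounded_clinear_add[OF E_clinear[OF that X]] cinner_add_right)
    then show "cmean (form X x (y + y')) = cmean (form X x y) + cmean (form X x y')"
      using cmean_cong[OF cont, of x "y + y'" "\<lambda>g. form X x y g + form X x y' g"]
      by (simp add: cmean_add cont)
    have "form X x (c *\<^sub>C y) g = c * form X x y g" if "g \<in> carrier G" for g
      by (simp add: form_def bounded_clinear_scaleC[OF lin[OF that]]
          bounded_clinear_scaleC[OF E_clinear[OF that X]] cinner_scaleC_right)
    then show "cmean (form X x (c *\<^sub>C y)) = c * cmean (form X x y)"
      using cmean_cong[OF cont, of x "c *\<^sub>C y" "\<lambda>g. c * form X x y g"]
      by (simp add: cmean_cmult cont)
  qed blast
  from someI_ex[OF this] show "bounded_clinear (twirl X)" "cinner x (twirl X y) = cmean (form X x y)"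
    unfolding twirl_def by blast+
qed

lemma twirl_plus:
  assumes "trace_class X" "trace_class Y"
  shows "twirl (\<lambda>x. X x + Y x) = (\<lambda>x. twirl X x + twirl Y x)"
proof (rule op_eqI)
  fix x y
  show "cinner x (twirl (\<lambda>x. X x + Y x) y) = cinner x (twirl X y + twirl Y y)"
    using cmean_cong[OF ccont_form[OF trace_class_plus[OF assms]], of x y "\<lambda>g. form X x y g + form Y x y g"]
    by (simp add: cinner_add_right cinner_twirl assms trace_class_plus form_plus cmean_add ccont_form)
qed

lemma twirl_scale:
  assumes "trace_class X"
  shows "twirl (\<lambda>x. c *\<^sub>C X x) = (\<lambda>x. c *\<^sub>C twirl X x)"
proof (rule op_eqI)
  fix x y
  show "cinner x (twirl (\<lambda>x. c *\<^sub>C X x) y) = cinner x (c *\<^sub>C twirl X y)"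
    using cmean_cong[OF ccont_form[OF trace_class_scale[OF assms]], of c x y "\<lambda>g. c * form X x y g"]
    by (simp add: cinner_scaleC_right cinner_twirl assms trace_class_scale form_scale cmean_cmult ccont_form)
qed

section \<open>Positivity and trace of the twirl\<close>

lemma E_conj_positive:
  assumes "positive_finite_trace P" "g \<in> carrier G"
  shows "positive_finite_trace (E (conj_op U g P))" "op_trace (E (conj_op U g P)) = op_trace P"
  using channel_positive[OF channel conj_op_positive[OF assms(2,1)]]
    channel_trace[OF channel conj_op_trace_class[OF assms(2) trace_class_positive[OF assms(1)]]]
    trace_conj[OF unitary[OF assms(2)] assms(1)]
  by (auto simp: conj_op_def)

lemma sum_twirl:
  assumes "trace_class X" "finite F"
  shows "(\<Sum>e\<in>F. Re (cinner e (twirl X e))) = Re (cmean (\<lambda>g. \<Sum>e\<in>F. form X e e g))"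
  using assms by (simp add: cinner_twirl cmean_sum ccont_form)

text \<open>A finite partial sum of the trace commutes with the mean, and for every g it is at most
  tr P because \<open>U g\<close> keeps basis vectors orthonormal. The reverse inequality needs one
  finite set that is good for all g.\<close>

lemma twirl_positive:
  assumes P: "positive_finite_trace P"
  shows "positive_finite_trace (twirl P)" and trace_twirl_le: "Re (op_trace (twirl P)) \<le> Re (op_trace P)"
proof -
  note tc = trace_class_positive[OF P]
  have "form P x x g \<in> \<real>\<^sub>\<ge>\<^sub>0" if "g \<in> carrier G" for x g
    using positive_finite_trace_positive[OF E_conj_positive(1)[OF P that]]
    by (simp add: form_def positive_op_def)
  then have "positive_op (twirl P)"
    unfolding positive_op_def using twirl_clinear[OF tc] by (simp add: cinner_twirl[OF tc] cmean_nonneg ccont_form tc)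
  moreover have "(\<Sum>e\<in>F. Re (cinner e (twirl P e))) \<le> Re (op_trace P)" if F: "finite F" "F \<subseteq> onb" for F
    unfolding sum_twirl[OF tc F(1)]
  proof (rule Re_cmean_upper)
    show "ccont (\<lambda>g. \<Sum>e\<in>F. form P e e g)"
      by (intro ccont_sum ccont_form tc)
    show "Re (\<Sum>e\<in>F. form P e e g) \<le> Re (op_trace P)" if g: "g \<in> carrier G" for g
      using unitary_sum_le_trace[OF unitary[OF g] E_conj_positive(1)[OF P g] F] E_conj_positive(2)[OF P g]
      by (simp add: form_def)
  qed
  ultimately show "positive_finite_trace (twirl P)" "Re (op_trace (twirl P)) \<le> Re (op_trace P)"
    using positive_finite_traceI by blast+
qed

text \<open>Dini's theorem: the partial traces of \<open>U(g)\<^sup>\<dagger> E(U(g) P U(g)\<^sup>\<dagger>) U(g)\<close> are continuous in \<open>g\<close> and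
  increase to the constant \<open>tr P\<close>, so finitely many basis vectors nearly exhaust it uniformly in \<open>g\<close>.\<close>

lemma uniform_trace_approx:
  assumes P: "positive_finite_trace P" and d: "d > 0"
  obtains F where "finite F" "F \<subseteq> onb"
    "\<And>g. g \<in> carrier G \<Longrightarrow> Re (op_trace P) - d \<le> Re (\<Sum>e\<in>F. form P e e g)"
proof -
  note tc = trace_class_positive[OF P]
  define s where "s F g = Re (\<Sum>e\<in>F. form P e e g)" for F g
  have s_mono: "s F g \<le> s F' g" if "finite F'" "F \<subseteq> F'" "g \<in> carrier G" for F F' g
    unfolding s_def Re_sum form_def
    using that positive_op_nonneg[OF positive_finite_trace_positive[OF E_conj_positive(1)[OF P that(3)]]]
    by (intro sum_mono2) simp_all
  have s_cont: "cont (s F)" for F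
    unfolding s_def[abs_def] by (intro ccont_Re ccont_sum ccont_form tc)
  have "\<exists>F. finite F \<and> F \<subseteq> onb \<and> Re (op_trace P) - d < s F g" if g: "g \<in> carrier G" for g
  proof -
    \<comment> \<open>\<open>?V \<circ> ?Q \<circ> cadjoint ?V\<close> is the operator averaged at
      g, and its trace is tr P. The error d / 2 leaves room for the strict inequality that makes the
      sets \<open>W g\<close> open.\<close>
    let ?V = "cadjoint (U g)" and ?Q = "E (conj_op U g P)"
    have V: "unitary_op ?V" by (rule unitary_op_cadjoint[OF unitary[OF g]])
    have Q: "positive_finite_trace ?Q" "op_trace ?Q = op_trace P"
      using E_conj_positive[OF P g] by auto
    obtain F where F: "finite F" "F \<subseteq> onb"
      "Re (op_trace (?V \<circ> ?Q \<circ> cadjoint ?V)) \<le> (\<Sum>b\<in>F. Re (cinner b ((?V \<circ> ?Q \<circ> cadjoint ?V) b))) + d / 2"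
      using trace_approx[OF conj_positive_finite_trace[OF V Q(1)], of "d / 2"] d by auto
    have "cinner b ((?V \<circ> ?Q \<circ> cadjoint ?V) b) = form P b b g" for b
      by (simp add: form_def cadjoint_cadjoint[OF unitary[OF g]] cinner_cadjoint_right[OF unitary[OF g]])
    then have "Re (op_trace P) \<le> s F g + d / 2"
      using F(3) by (simp only: s_def Re_sum trace_conj[OF V Q(1)] Q(2))
    with F d show ?thesis by (intro exI[of _ F]) simp
  qed
  then obtain F where F: "\<And>g. g \<in> carrier G \<Longrightarrow> finite (F g)" "\<And>g. g \<in> carrier G \<Longrightarrow> F g \<subseteq> onb"
    "\<And>g. g \<in> carrier G \<Longrightarrow> Re (op_trace P) - d < s (F g) g"
    by metis
  define W where "W g = {h \<in> topspace T. s (F g) h \<in> {Re (op_trace P) - d<..}}" for g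
  have "\<forall>U\<in>W ` carrier G. openin T U"
    unfolding W_def by (auto intro!: openin_continuous_map_preimage[OF s_cont] simp del: greaterThan_iff)
  moreover have "topspace T \<subseteq> \<Union>(W ` carrier G)"
    unfolding W_def using F(3) by (auto simp: topspace_eq)
  ultimately have "\<exists>\<F>. finite \<F> \<and> \<F> \<subseteq> W ` carrier G \<and> topspace T \<subseteq> \<Union>\<F>"
    using compact by (simp add: compact_space_alt)
  then obtain C where C: "finite C" "C \<subseteq> carrier G" "carrier G \<subseteq> \<Union>(W ` C)"
    by (metis finite_subset_image topspace_eq)
  show ?thesis
  \<comment> \<open>As \<open>s\<close> grows with the finite set, the union over the finite cover
    is good at every g.\<close>
  proof (rule that[of "\<Union>(F ` C)"])
    show fin: "finite (\<Union>(F ` C))" "\<Union>(F ` C) \<subseteq> onb"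
      using C(1,2) F(1,2) by (auto simp: subset_iff)
    fix g assume g: "g \<in> carrier G"
    then obtain c where c: "c \<in> C" "g \<in> W c"
      using C(3) by blast
    then have "Re (op_trace P) - d \<le> s (F c) g"
      by (simp add: W_def)
    also have "\<dots> \<le> s (\<Union>(F ` C)) g"
      using c(1) by (intro s_mono fin g) auto
    finally show "Re (op_trace P) - d \<le> Re (\<Sum>e\<in>\<Union>(F ` C). form P e e g)"
      by (simp only: s_def)
  qed
qed

text \<open>The uniform lower bound survives the mean of a finite partial sum, which is a partial
  sum for the trace of the twirl.\<close>

lemma trace_twirl_positive:
  assumes P: "positive_finite_trace P"
  shows "op_trace (twirl P) = op_trace P"
proof -
  have "Re (op_trace P) \<le> Re (op_trace (twirl P))"
  proof (rule field_le_epsilon)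
    fix d :: real assume "d > 0"
    then obtain F where F: "finite F" "F \<subseteq> onb"
      "\<And>g. g \<in> carrier G \<Longrightarrow> Re (op_trace P) - d \<le> Re (\<Sum>e\<in>F. form P e e g)"
      using uniform_trace_approx[OF P] by metis
    have "Re (op_trace P) - d \<le> Re (cmean (\<lambda>g. \<Sum>e\<in>F. form P e e g))"
      by (rule Re_cmean_lower[OF ccont_sum[OF ccont_form[OF trace_class_positive[OF P]]] F(3)])
    also have "\<dots> \<le> Re (op_trace (twirl P))"
      unfolding sum_twirl[OF trace_class_positive[OF P] F(1), symmetric]
      by (rule onb_sum_le_trace[OF twirl_positive(1)[OF P] F(2,1)])
    finally show "Re (op_trace P) \<le> Re (op_trace (twirl P)) + d" by simp
  qed
  then show ?thesis
    using trace_twirl_le[OF P] positive_finite_trace_Im[OF P]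
      positive_finite_trace_Im[OF twirl_positive(1)[OF P]] by (simp add: complex_eq_iff)
qed

lemma trace_class_twirl: "trace_class X \<Longrightarrow> trace_class (twirl X) \<and> op_trace (twirl X) = op_trace X"
  by (induction rule: trace_class_induct)
    (simp_all add: trace_class_positive twirl_positive trace_twirl_positive twirl_plus twirl_scale
      trace_class_plus trace_class_scale op_trace_plus op_trace_scale)

text \<open>Blockwise conjugation is conjugation by the block diagonal unitary with entries
  \<open>U g\<close>, so it keeps positivity, as does the channel; what remains is the mean of a
  nonnegative function.\<close>

lemma twirl_positive_block:
  assumes tc: "\<And>i j. i < n \<Longrightarrow> j < n \<Longrightarrow> trace_class (X i j)" and pos: "positive_block n X"
  shows "positive_block n (\<lambda>i j. twirl (X i j))"
  unfolding positive_block_def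
proof
  fix \<xi> :: "nat \<Rightarrow> 'h"
  have cont: "ccont (form (X i j) (\<xi> i) (\<xi> j))" if "i < n" "j < n" for i j
    by (intro ccont_form tc that)
  have "(\<Sum>i<n. \<Sum>j<n. cinner (\<xi> i) (twirl (X i j) (\<xi> j)))
      = (\<Sum>i<n. \<Sum>j<n. cmean (form (X i j) (\<xi> i) (\<xi> j)))"
    using tc by (intro sum.cong refl) (simp add: cinner_twirl)
  also have "\<dots> = (\<Sum>i<n. cmean (\<lambda>g. \<Sum>j<n. form (X i j) (\<xi> i) (\<xi> j) g))"
    using cont by (intro sum.cong refl cmean_sum[symmetric]) auto
  also have "\<dots> = cmean (\<lambda>g. \<Sum>i<n. \<Sum>j<n. form (X i j) (\<xi> i) (\<xi> j) g)"
    using cont by (intro cmean_sum[symmetric] ccont_sum) auto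
  also have "\<dots> \<in> \<real>\<^sub>\<ge>\<^sub>0"
  proof (rule cmean_nonneg)
    show "ccont (\<lambda>g. \<Sum>i<n. \<Sum>j<n. form (X i j) (\<xi> i) (\<xi> j) g)"
      using cont by (intro ccont_sum) auto
    fix g assume g: "g \<in> carrier G"
    have "positive_block n (\<lambda>i j. conj_op U g (X i j))"
      unfolding positive_block_def
    proof
      fix \<eta> :: "nat \<Rightarrow> 'h"
      show "(\<Sum>i<n. \<Sum>j<n. cinner (\<eta> i) (conj_op U g (X i j) (\<eta> j))) \<in> \<real>\<^sub>\<ge>\<^sub>0"
        using pos[unfolded positive_block_def, rule_format, of "\<lambda>i. cadjoint (U g) (\<eta> i)"]
        by (simp add: conj_op_def cinner_cadjoint_right[OF unitary[OF g]])
    qed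
    then have "positive_block n (\<lambda>i j. E (conj_op U g (X i j)))"
      by (intro channel_positive_block[OF channel] conj_op_trace_class g tc)
    then show "(\<Sum>i<n. \<Sum>j<n. form (X i j) (\<xi> i) (\<xi> j) g) \<in> \<real>\<^sub>\<ge>\<^sub>0"
      unfolding positive_block_def form_def by (rule spec)
  qed
  finally show "(\<Sum>i<n. \<Sum>j<n. cinner (\<xi> i) (twirl (X i j) (\<xi> j))) \<in> \<real>\<^sub>\<ge>\<^sub>0" .
qed

lemma quantum_channel_twirl: "quantum_channel twirl"
  unfolding quantum_channel_def linear_map_def trace_preserving_def completely_positive_def
  by (simp add: trace_class_twirl twirl_plus twirl_scale twirl_positive_block)

section \<open>Covariance and the value at \<rho>\<close>

lemma conj_op_mult:
  assumes g: "g \<in> carrier G" and h: "h \<in> carrier G"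
  shows "conj_op U (g \<otimes> h) X = conj_op U g (conj_op U h X)"
proof -
  have "cadjoint (U (g \<otimes> h)) x = cadjoint (U h) (cadjoint (U g) x)" for x
  proof (rule cinner_right_eqI)
    fix y
    show "cinner y (cadjoint (U (g \<otimes> h)) x) = cinner y (cadjoint (U h) (cadjoint (U g) x))"
      unfolding cinner_cadjoint_right(2)[OF unitary, symmetric, OF m_closed[OF g h]]
        cinner_cadjoint_right(2)[OF unitary, symmetric, OF h]
        cinner_cadjoint_right(2)[OF unitary, symmetric, OF g]
      by (simp add: rep_mult[OF g h])
  qed
  then show ?thesis
    by (simp add: conj_op_def fun_eq_iff rep_mult[OF g h])
qed

text \<open>Conjugating the argument by h amounts to replacing g by \<open>g \<otimes> h\<close> and
  moving the adjoint of \<open>U h\<close> onto x and y; right invariance of the mean then removes h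
  from g.\<close>

lemma covariant_twirl: "covariant G U twirl"
  unfolding covariant_def
proof (intro ballI allI impI)
  fix h X assume h: "h \<in> carrier G" and X: "trace_class (X :: 'h \<Rightarrow> 'h)"
  show "twirl (conj_op U h X) = conj_op U h (twirl X)"
  proof (rule op_eqI)
    fix x y
    let ?x = "cadjoint (U h) x" and ?y = "cadjoint (U h) y"
    have "form (conj_op U h X) x y g = form X ?x ?y (g \<otimes> h)" if "g \<in> carrier G" for g
      unfolding form_def rep_mult[OF that h] conj_op_mult[OF that h] unitary_cadjoint_right[OF unitary[OF h]] ..
    then have "cmean (form (conj_op U h X) x y) = cmean (\<lambda>g. form X ?x ?y (g \<otimes> h))"
      by (rule cmean_cong[OF ccont_form[OF conj_op_trace_class[OF h X]]])
    also have "\<dots> = cmean (form X ?x ?y)"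
      by (rule cmean_translate[OF ccont_form[OF X] h])
    also have "\<dots> = cinner x (conj_op U h (twirl X) y)"
      by (simp add: cinner_twirl[OF X] conj_op_def cinner_cadjoint_right(1)[OF unitary[OF h]])
    finally show "cinner x (twirl (conj_op U h X) y) = cinner x (conj_op U h (twirl X) y)"
      unfolding cinner_twirl[OF conj_op_trace_class[OF h X]] .
  qed
qed

text \<open>Under (B) the averaged operator is \<sigma> for every g, and the mean fixes
  constants.\<close>

lemma twirl_eq:
  assumes \<rho>: "trace_class \<rho>"
    and E: "\<And>g. g \<in> carrier G \<Longrightarrow> E (conj_op U g \<rho>) = conj_op U g \<sigma>"
  shows "twirl \<rho> = \<sigma>"
proof (rule op_eqI)
  fix x y
  have "form \<rho> x y g = cinner x (\<sigma> y)" if g: "g \<in> carrier G" for g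
    using unitary[OF g] unfolding form_def E[OF g]
    by (simp add: conj_op_def unitary_cadjoint_left unitary_op_def)
  then have "cmean (form \<rho> x y) = cmean (\<lambda>g. cinner x (\<sigma> y))"
    by (rule cmean_cong[OF ccont_form[OF \<rho>]])
  then show "cinner x (twirl \<rho> y) = cinner x (\<sigma> y)"
    by (simp add: cinner_twirl[OF \<rho>] cmean_const)
qed

end

section \<open>Finite groups, compact Lie groups and the equivalence\<close>

lemma compact_group_discrete:
  assumes "group G" "finite (carrier G)"
  shows "compact_group G (discrete_topology (carrier G))"
proof -
  interpret group G by (rule assms)
  show ?thesis
    by unfold_locales (auto simp: assms compact_space_discrete_topology
        prod_topology_discrete_topology[symmetric])
qed

lemma compact_group_lie:
  assumes "compact_lie_group G T A"
  shows "compact_group G T"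
proof -
  have "group G" using assms by (simp add: compact_lie_group_def lie_group_def)
  then interpret group G .
  show ?thesis
    by unfold_locales (use assms in \<open>simp_all add: compact_lie_group_def lie_group_def\<close>)
qed

theorem lemma1:
  fixes G :: "('g, 'm) monoid_scheme"
    and T :: "'g topology"
    and A :: "('g set \<times> ('g \<Rightarrow> 'e::euclidean_space)) set"
    and U :: "'g \<Rightarrow> 'h::chilbert_space \<Rightarrow> 'h"
    and \<rho> \<sigma> :: "'h \<Rightarrow> 'h"
  assumes "(group G \<and> finite (carrier G)) \<or> (compact_lie_group G T A \<and> strongly_continuous T U)"
    and "unitary_rep G U"
    and "density_op \<rho>"
    and "density_op \<sigma>"
  shows "(\<exists>E. quantum_channel E \<and> covariant G U E \<and> E \<rho> = \<sigma>) \<longleftrightarrow>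
         (\<exists>E. quantum_channel E \<and> (\<forall>g\<in>carrier G. E (conj_op U g \<rho>) = conj_op U g \<sigma>))"
proof -
  have \<rho>: "trace_class \<rho>"
    using assms(3) by (simp add: density_op_def trace_class_positive)
  \<comment> \<open>In the finite case the topology \<open>T\<close> of the statement is unrelated
    to the group, so another topology may have to take its place.\<close>
  have "\<exists>T'. compact_group G T' \<and> strongly_continuous T' U"
    using assms(1)
  proof
    assume G: "group G \<and> finite (carrier G)"
    have "strongly_continuous (discrete_topology (carrier G)) U"
      by (simp add: strongly_continuous_def)
    with G show ?thesis
      using compact_group_discrete by blast
  next
    assume "compact_lie_group G T A \<and> strongly_continuous T U"
    then show ?thesis
      using compact_group_lie by blast
  qed
  then obtain T' where T': "compact_group G T'" "strongly_continuous T' U"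
    by blast
  show ?thesis
  proof
    assume "\<exists>E. quantum_channel E \<and> covariant G U E \<and> E \<rho> = \<sigma>"
    \<comment> \<open>Covariance applies to \<rho> because a density operator is trace class; the
      same channel serves.\<close>
    then show "\<exists>E. quantum_channel E \<and> (\<forall>g\<in>carrier G. E (conj_op U g \<rho>) = conj_op U g \<sigma>)"
      using \<rho> unfolding covariant_def by blast
  next
    assume "\<exists>E. quantum_channel E \<and> (\<forall>g\<in>carrier G. E (conj_op U g \<rho>) = conj_op U g \<sigma>)"
    then obtain E where E: "quantum_channel E" "\<And>g. g \<in> carrier G \<Longrightarrow> E (conj_op U g \<rho>) = conj_op U g \<sigma>"
      by blast
    interpret channel_twirl G T' U E
      using T' assms(2) E(1) by (intro channel_twirl.intro channel_twirl_axioms.intro)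
    show "\<exists>E. quantum_channel E \<and> covariant G U E \<and> E \<rho> = \<sigma>"
      using quantum_channel_twirl covariant_twirl twirl_eq[OF \<rho> E(2)] by blast
  qed
qed

end
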